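(* Fix an RBG allocation $\mathbf k$ and let $f(\cdot\,;\mathbf k)$ be the weighted sum rate (WSR). Let $\tau\ge 1$ and let $\mathbf V^{(\tau-1)}=\{\mathbf V^{(\tau-1)}_{u,i}\}_{(u,i)\in\mathcal S}$ be feasible, i.e. $\|\mathbf V^{(\tau-1)}_{u,i}\|_F^2\le P_{\max}$ for every active slot $(u,i)\in\mathcal S$. Let the auxiliary variables $\mathbf\Gamma^{(\tau)},\mathbf Y^{(\tau)}$ (and hence $\mathbf\Lambda_{u,i}^{(\tau)},\mathbf L_{u,i}^{(\tau)}$) be computed at $\mathbf V^{(\tau-1)}$, and for every active slot choose a real number $\lambda_{u,i}^{(\tau)}>0$ with $\lambda_{u,i}^{(\tau)}\ge\lambda_{\max}(\mathbf L_{u,i}^{(\tau)})$. If $\alpha_{u,i}^{(\tau)}\in(0,2)$ for all active $(u,i)$, then the bounded projected update $$\mathbf V_{u,i}^{(\tau)}=\mathcal P_{\mathcal W}\Big[\mathbf V_{u,i}^{(\tau-1)}+\alpha_{u,i}^{(\tau)}\big(\widetilde{\mathbf V}_{u,i}^{\mathrm{FP},(\tau)}-\mathbf V_{u,i}^{(\tau-1)}\big)\Big],\qquad (u,i)\in\mathcal S,$$ where $$\widetilde{\mathbf V}_{u,i}^{\mathrm{FP},(\tau)}=\mathbf V_{u,i}^{(\tau-1)}+\frac{1}{\lambda_{u,i}^{(\tau)}}\Big(\mathbf\Lambda_{u,i}^{(\tau)}-\mathbf L_{u,i}^{(\tau)}\mathbf V_{u,i}^{(\tau-1)}\Big),$$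 satisfies $$f(\mathbf V^{(\tau)};\mathbf k)\ \ge\ f(\mathbf V^{(\tau-1)};\mathbf k).$$ Consequently, if these conditions hold at every iteration $\tau\ge1$, the WSR sequence $\big(f(\mathbf V^{(\tau)};\mathbf k)\big)_{\tau\ge 0}$ generated by these beamforming updates is monotonically nondecreasing for fixed $\mathbf k$.
   Context: **Network.** There are finitely many base stations, users $u\in[U]$, and resource block groups (RBGs) $[K]$, where $[n]=\{0,\dots,n-1\}$. User $u$ is served by base station $b_u$, has priority weight $\rho_u\ge 0$, receives $d_u$ streams, and has $N$ logical slots $i\in[N]$. Each base station has $M_t$ transmit antennas and each user $M_r$ receive antennas. $\mathbf H_{b,n,u}\in\mathbb C^{M_r\times M_t}$ is the given channel from base station $b$ to user $u$ on RBG $n$. The noise power is $\sigma^2>0$ and the power budget is $P_{\max}>0$. **Allocation.** An RBG allocation $\mathbf k=(k_{u,i})$ assigns to each slot $(u,i)$ an element $k_{u,i}\in[K]\cup\{\emptyset\}$. The slot is active if $k_{u,i}\ne\emptyset$; $\mathcal S$ denotes the set of active slots. Inactive slots contribute nothing to the objective. For an active slot, $\mathcal C_{u,i}=\{(j,\ell)\in\mathcal S: k_{j,\ell}=k_{u,i}\}$ and $\mathbf H_{u,i}=\mathbf H_{b_u,k_{u,i},u}$. **Objective.** The variable is $\mathbf V=\{\mathbf V_{u,i}\}_{(u,i)\in\mathcal S}$ with $\mathbf V_{u,i}\in\mathbb C^{M_t\times d_u}$. Put $$\mathbf M_{u,i}(\mathbf V)=\sum_{(j,\ell)\in\mathcal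 C_{u,i}\setminus\{(u,i)\}}\mathbf H_{b_j,k_{u,i},u}\mathbf V_{j,\ell}\mathbf V_{j,\ell}^H\mathbf H_{b_j,k_{u,i},u}^H+\sigma^2\mathbf I_{M_r},$$ $$\mathbf J_{u,i}(\mathbf V)=\mathbf H_{u,i}\mathbf V_{u,i}\mathbf V_{u,i}^H\mathbf H_{u,i}^H+\mathbf M_{u,i}(\mathbf V),$$ $$f(\mathbf V;\mathbf k)=\sum_{(u,i)\in\mathcal S}\rho_u\log\det\big(\mathbf I_{d_u}+\mathbf V_{u,i}^H\mathbf H_{u,i}^H\mathbf M_{u,i}(\mathbf V)^{-1}\mathbf H_{u,i}\mathbf V_{u,i}\big),$$ with natural logarithm. **Auxiliary quantities at iteration $\tau$**, all evaluated at $\mathbf V=\mathbf V^{(\tau-1)}$: $$\mathbf\Gamma_{u,i}^{(\tau)}=\mathbf V_{u,i}^H\mathbf H_{u,i}^H\mathbf M_{u,i}^{-1}\mathbf H_{u,i}\mathbf V_{u,i},\qquad \mathbf Y_{u,i}^{(\tau)}=\mathbf J_{u,i}^{-1}\mathbf H_{u,i}\mathbf V_{u,i},$$ $$\mathbf\Lambda_{u,i}^{(\tau)}=\rho_u\mathbf H_{u,i}^H\mathbf Y_{u,i}^{(\tau)}(\mathbf I_{d_u}+\mathbf\Gamma_{u,i}^{(\tau)}),\qquad \mathbf\Psi_{j,\ell}^{(\tau)}=\mathbf Y_{j,\ell}^{(\tau)}(\mathbf I_{d_j}+\mathbf\Gamma_{j,\ell}^{(\tau)})\mathbf Y_{j,\ell}^{(\tau)H},$$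 $$\mathbf L_{u,i}^{(\tau)}=\sum_{(j,\ell)\in\mathcal C_{u,i}}\rho_j\,\mathbf H_{b_u,k_{u,i},j}^H\mathbf\Psi_{j,\ell}^{(\tau)}\mathbf H_{b_u,k_{u,i},j}.$$ $\lambda_{\max}(\cdot)$ is the largest eigenvalue of a Hermitian matrix. **Projection.** $\mathcal P_{\mathcal W}$ is the Euclidean (Frobenius) projection onto the ball $\{\mathbf X:\|\mathbf X\|_F^2\le P_{\max}\}$, i.e. $\mathcal P_{\mathcal W}(\mathbf X)=\min\{1,\sqrt{P_{\max}}/\|\mathbf X\|_F\}\,\mathbf X$ (and $\mathcal P_{\mathcal W}(\mathbf 0)=\mathbf 0$). *)

theory Defs
  imports
    "HOL-Analysis.Analysis"
    "Jordan_Normal_Form.Determinant"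
    "Jordan_Normal_Form.Char_Poly"
    "Jordan_Normal_Form.Gauss_Jordan_Elimination"
    "Jordan_Normal_Form.Schur_Decomposition"
begin

hide_const (open) Determinants.det

section \<open>Complex matrices\<close>

text \<open>The number of streams depends on the user, so matrices carry their dimensions as values.\<close>

notation mat_adjoint (\<open>_\<^sup>H\<close> [1000] 1000)

definition mat_sum ::
  "nat \<Rightarrow> nat \<Rightarrow> ('s \<Rightarrow> complex mat) \<Rightarrow> 's set \<Rightarrow> complex mat" where
  "mat_sum nr nc F S = mat nr nc (\<lambda>ij. \<Sum>s\<in>S. F s $$ ij)"

text \<open>Below, the inverse is taken of positive definite matrices only, where
  \<^const>\<open>mat_inverse\<close> is not \<^const>\<open>None\<close>.\<close>

definition mat_inv :: "complex mat \<Rightarrow> complex mat" where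
  "mat_inv A = the (mat_inverse A)"

definition rscale :: "real \<Rightarrow> complex mat \<Rightarrow> complex mat" where
  "rscale c A = complex_of_real c \<cdot>\<^sub>m A"

definition frob_norm :: "complex mat \<Rightarrow> real" where
  "frob_norm X = sqrt (sum_mat (map_mat (\<lambda>z. (cmod z)\<^sup>2) X))"

text \<open>For a Hermitian matrix of positive dimension all eigenvalues are real and the set is
  finite and nonempty.\<close>

definition lambda_max :: "complex mat \<Rightarrow> real" where
  "lambda_max A = Max {x. eigenvalue A (complex_of_real x)}"

text \<open>Used for matrices whose determinant is a positive real number.\<close>

definition log_det :: "complex mat \<Rightarrow> real" where
  "log_det A = ln (Re (det A))"

text \<open>Projection onto the ball of squared radius \<open>P\<close>. For \<open>X = 0\<close> the factor is \<open>min 1 0\<close>,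
  because division by zero yields zero, and the result is the zero matrix.\<close>

definition ball_proj :: "real \<Rightarrow> complex mat \<Rightarrow> complex mat" where
  "ball_proj P X = rscale (min 1 (sqrt P / frob_norm X)) X"

lemma frob_norm_L2:
  "X \<in> carrier_mat n m \<Longrightarrow>
    frob_norm X = L2_set (\<lambda>ij. cmod (X $$ ij)) ({0..<n} \<times> {0..<m})"
  unfolding frob_norm_def sum_mat_def L2_set_def
  by (auto intro!: arg_cong[of _ _ sqrt] sum.cong)

lemma frob_norm_rscale: "frob_norm (rscale c X) = \<bar>c\<bar> * frob_norm X"
proof -
  have X: "X \<in> carrier_mat (dim_row X) (dim_col X)" by simp
  have cX: "rscale c X \<in> carrier_mat (dim_row X) (dim_col X)"
    by (simp add: rscale_def)
  have "frob_norm (rscale c X)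
      = L2_set (\<lambda>ij. \<bar>c\<bar> * cmod (X $$ ij)) ({0..<dim_row X} \<times> {0..<dim_col X})"
    unfolding frob_norm_L2[OF cX]
    by (rule L2_set_cong) (auto simp: rscale_def norm_mult)
  also have "\<dots> = \<bar>c\<bar> * frob_norm X"
    unfolding frob_norm_L2[OF X] by (simp add: L2_set_right_distrib)
  finally show ?thesis .
qed

lemma frob_norm_diff:
  assumes "X \<in> carrier_mat n m" "Z \<in> carrier_mat n m"
  shows "frob_norm X \<le> frob_norm Z + frob_norm (X - Z)"
proof -
  let ?I = "{0..<n} \<times> {0..<m}"
  have XZ: "X - Z \<in> carrier_mat n m" using assms(2) by (rule minus_carrier_mat)
  have "L2_set (\<lambda>ij. cmod (X $$ ij)) ?I
      \<le> L2_set (\<lambda>ij. cmod (Z $$ ij) + cmod ((X - Z) $$ ij)) ?I"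
  proof (rule L2_set_mono)
    fix ij assume "ij \<in> ?I"
    then have "X $$ ij = Z $$ ij + (X - Z) $$ ij" using assms by auto
    then show "cmod (X $$ ij) \<le> cmod (Z $$ ij) + cmod ((X - Z) $$ ij)"
      by (metis norm_triangle_ineq)
  qed auto
  also have "\<dots> \<le> L2_set (\<lambda>ij. cmod (Z $$ ij)) ?I + L2_set (\<lambda>ij. cmod ((X - Z) $$ ij)) ?I"
    by (rule L2_set_triangle_ineq)
  finally show ?thesis
    using assms XZ by (simp add: frob_norm_L2[of _ n m])
qed

text \<open>The closed form is a nearest point of the ball.\<close>

lemma ball_proj_nearest:
  assumes P: "0 < P" and X: "X \<in> carrier_mat n m"
  shows "ball_proj P X \<in> carrier_mat n m"
    and "(frob_norm (ball_proj P X))\<^sup>2 \<le> P"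
    and "Z \<in> carrier_mat n m \<Longrightarrow> (frob_norm Z)\<^sup>2 \<le> P \<Longrightarrow>
      frob_norm (X - ball_proj P X) \<le> frob_norm (X - Z)"
proof -
  define c where "c = min 1 (sqrt P / frob_norm X)"
  have pr: "ball_proj P X = rscale c X" by (simp add: ball_proj_def c_def)
  have nn: "frob_norm Y \<ge> 0" for Y
    by (auto simp: frob_norm_def sum_mat_def intro!: sum_nonneg)
  have c: "0 \<le> c" "c \<le> 1" using P nn[of X] by (auto simp: c_def)
  show "ball_proj P X \<in> carrier_mat n m" using X by (simp add: pr rscale_def)
  have eq: "c * frob_norm X = min (frob_norm X) (sqrt P)"
    using P nn[of X] by (cases "frob_norm X = 0") (auto simp: c_def min_def field_simps)
  then have "frob_norm (ball_proj P X) \<le> sqrt P"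
    using c by (simp add: pr frob_norm_rscale)
  then have "(frob_norm (ball_proj P X))\<^sup>2 \<le> (sqrt P)\<^sup>2"
    using nn power_mono by blast
  then show "(frob_norm (ball_proj P X))\<^sup>2 \<le> P" using P by simp
  assume Z: "Z \<in> carrier_mat n m" and "(frob_norm Z)\<^sup>2 \<le> P"
  then have "frob_norm Z \<le> sqrt P" using real_le_rsqrt by blast
  have "X - ball_proj P X = rscale (1 - c) X"
    using X by (intro eq_matI) (auto simp: pr rscale_def algebra_simps)
  then have "frob_norm (X - ball_proj P X) = frob_norm X - c * frob_norm X"
    using c by (simp add: frob_norm_rscale algebra_simps)
  also have "\<dots> \<le> frob_norm (X - Z)"
    using frob_norm_diff[OF X Z] \<open>frob_norm Z \<le> sqrt P\<close> nn[of "X - Z"] eq by linarith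
  finally show "frob_norm (X - ball_proj P X) \<le> frob_norm (X - Z)" .
qed


section \<open>Network and allocation\<close>

text \<open>\<open>channel net b n u\<close> is the channel from base station \<open>b\<close> to user \<open>u\<close> on resource block
  group \<open>n\<close>; \<open>noise_power\<close> is \<open>\<sigma>\<^sup>2\<close>.\<close>

record network =
  num_bs :: nat
  num_users :: nat
  num_rbgs :: nat
  num_slots :: nat
  serving_bs :: "nat \<Rightarrow> nat"
  weight :: "nat \<Rightarrow> real"
  streams :: "nat \<Rightarrow> nat"
  tx_ants :: nat
  rx_ants :: nat
  channel :: "nat \<Rightarrow> nat \<Rightarrow> nat \<Rightarrow> complex mat"
  noise_power :: real
  power_budget :: real

definition valid_network :: "network \<Rightarrow> bool" where
  "valid_network net \<longleftrightarrow>
    (\<forall>u<num_users net. serving_bs net u < num_bs net \<and> 0 \<le> weight net u) \<and>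
    (\<forall>b<num_bs net. \<forall>n<num_rbgs net. \<forall>u<num_users net.
      channel net b n u \<in> carrier_mat (rx_ants net) (tx_ants net)) \<and>
    0 < noise_power net \<and> 0 < power_budget net"

text \<open>In an allocation, \<^const>\<open>None\<close> marks an inactive slot.\<close>

type_synonym alloc = "nat \<Rightarrow> nat \<Rightarrow> nat option"

type_synonym beams = "nat \<Rightarrow> nat \<Rightarrow> complex mat"

definition valid_alloc :: "network \<Rightarrow> alloc \<Rightarrow> bool" where
  "valid_alloc net k \<longleftrightarrow>
    (\<forall>u<num_users net. \<forall>i<num_slots net. \<forall>n. k u i = Some n \<longrightarrow> n < num_rbgs net)"

definition active_slots :: "network \<Rightarrow> alloc \<Rightarrow> (nat \<times> nat) set" where
  "active_slots net k = {(u, i). u < num_users net \<and> i < num_slots net \<and> k u i \<noteq> None}"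

definition cochannel :: "network \<Rightarrow> alloc \<Rightarrow> nat \<Rightarrow> nat \<Rightarrow> (nat \<times> nat) set" where
  "cochannel net k u i = {(j, l) \<in> active_slots net k. k j l = k u i}"

text \<open>\<open>chan_from net k b u i j\<close> is the channel from base station \<open>b\<close> to user \<open>j\<close> on the
  resource block group of the active slot \<open>(u, i)\<close>.\<close>

definition chan_from ::
  "network \<Rightarrow> alloc \<Rightarrow> nat \<Rightarrow> nat \<Rightarrow> nat \<Rightarrow> nat \<Rightarrow> complex mat" where
  "chan_from net k b u i j = channel net b (the (k u i)) j"

definition own_chan :: "network \<Rightarrow> alloc \<Rightarrow> nat \<Rightarrow> nat \<Rightarrow> complex mat" where
  "own_chan net k u i = chan_from net k (serving_bs net u) u i u"

text \<open>Only the entries of a \<^typ>\<open>beams\<close> family at active slots are meaningful.\<close>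

definition feasible :: "network \<Rightarrow> alloc \<Rightarrow> beams \<Rightarrow> bool" where
  "feasible net k V \<longleftrightarrow>
    (\<forall>(u, i)\<in>active_slots net k.
      V u i \<in> carrier_mat (tx_ants net) (streams net u) \<and>
      (frob_norm (V u i))\<^sup>2 \<le> power_budget net)"


section \<open>Weighted sum rate\<close>

definition M_mat :: "network \<Rightarrow> alloc \<Rightarrow> beams \<Rightarrow> nat \<Rightarrow> nat \<Rightarrow> complex mat" where
  "M_mat net k V u i =
    mat_sum (rx_ants net) (rx_ants net)
      (\<lambda>(j, l). chan_from net k (serving_bs net j) u i u * V j l * (V j l)\<^sup>H
         * (chan_from net k (serving_bs net j) u i u)\<^sup>H)
      (cochannel net k u i - {(u, i)})
    + rscale (noise_power net) (1\<^sub>m (rx_ants net))"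

definition J_mat :: "network \<Rightarrow> alloc \<Rightarrow> beams \<Rightarrow> nat \<Rightarrow> nat \<Rightarrow> complex mat" where
  "J_mat net k V u i =
    own_chan net k u i * V u i * (V u i)\<^sup>H * (own_chan net k u i)\<^sup>H + M_mat net k V u i"

definition Gamma_mat :: "network \<Rightarrow> alloc \<Rightarrow> beams \<Rightarrow> nat \<Rightarrow> nat \<Rightarrow> complex mat" where
  "Gamma_mat net k V u i =
    (V u i)\<^sup>H * (own_chan net k u i)\<^sup>H * mat_inv (M_mat net k V u i)
      * own_chan net k u i * V u i"

definition wsr :: "network \<Rightarrow> alloc \<Rightarrow> beams \<Rightarrow> real" where
  "wsr net k V =
    (\<Sum>(u, i)\<in>active_slots net k.
      weight net u * log_det (1\<^sub>m (streams net u) + Gamma_mat net k V u i))"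


section \<open>Bounded projected update\<close>

definition Y_mat :: "network \<Rightarrow> alloc \<Rightarrow> beams \<Rightarrow> nat \<Rightarrow> nat \<Rightarrow> complex mat" where
  "Y_mat net k V u i = mat_inv (J_mat net k V u i) * own_chan net k u i * V u i"

definition Lambda_mat :: "network \<Rightarrow> alloc \<Rightarrow> beams \<Rightarrow> nat \<Rightarrow> nat \<Rightarrow> complex mat" where
  "Lambda_mat net k V u i =
    rscale (weight net u)
      ((own_chan net k u i)\<^sup>H * Y_mat net k V u i
        * (1\<^sub>m (streams net u) + Gamma_mat net k V u i))"

definition Psi_mat :: "network \<Rightarrow> alloc \<Rightarrow> beams \<Rightarrow> nat \<Rightarrow> nat \<Rightarrow> complex mat" where
  "Psi_mat net k V j l =
    Y_mat net k V j l * (1\<^sub>m (streams net j) + Gamma_mat net k V j l) * (Y_mat net k V j l)\<^sup>H"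

definition L_mat :: "network \<Rightarrow> alloc \<Rightarrow> beams \<Rightarrow> nat \<Rightarrow> nat \<Rightarrow> complex mat" where
  "L_mat net k V u i =
    mat_sum (tx_ants net) (tx_ants net)
      (\<lambda>(j, l). rscale (weight net j)
         ((chan_from net k (serving_bs net u) u i j)\<^sup>H * Psi_mat net k V j l
           * chan_from net k (serving_bs net u) u i j))
      (cochannel net k u i)"

definition fp_point ::
  "network \<Rightarrow> alloc \<Rightarrow> beams \<Rightarrow> real \<Rightarrow> nat \<Rightarrow> nat \<Rightarrow> complex mat" where
  "fp_point net k V lam u i =
    V u i + rscale (1 / lam) (Lambda_mat net k V u i - L_mat net k V u i * V u i)"

definition bounded_update ::
  "network \<Rightarrow> alloc \<Rightarrow> beams \<Rightarrow> real \<Rightarrow> real \<Rightarrow> nat \<Rightarrow> nat \<Rightarrow> complex mat" where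
  "bounded_update net k V lam alpha u i =
    ball_proj (power_budget net)
      (V u i + rscale alpha (fp_point net k V lam u i - V u i))"

end

(*
  At the current point V, the rate of a slot with weight W = I + Gamma is minorized by a function of the
  beams that is concave and quadratic and agrees with the rate at V. Indeed, for the MMSE receivers
  Y (at V) and Y' (at V'), the matrices I - Y^H H V and I - Y'^H H V' are the inverses of W and
  W' = I + Gamma', the error covariance of Y at V' dominates W'^-1, and
  ln det W - ln det W' <= tr (W W'^-1) - d, because ln x <= x - 1 for the (positive) eigenvalues of
  W W'^-1. After exchanging the sums over interfering slots, the sum of these minorants separates over
  the beams, with gradient proportional to Lambda - L V and curvature L <= lambda I. The update is a
  projected gradient step of length alpha / lambda with alpha < 2, which increases each summand by the
  variational inequality of the projection.
*)

theory Submission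
  imports Defs
begin

section \<open>Matrix algebra\<close>

text \<open>The rate of a slot depends on all beams of its resource block group, so ascent cannot be
  proved slot by slot: one rate may drop while the sum grows. The exchange of sums works because the
  surrogate is quadratic through J rather than through M. J contains the own signal next to the
  interference, so its sum runs over the whole set \<open>cochannel\<close>, and sharing a resource
  block group is a symmetric relation. Two facts on eigenvalues carry the analysis, and no Hermitian
  matrix is diagonalized for either. \<open>lambda_max\<close> is a maximum over eigenvalues and has
  to be turned into a bound on a quadratic form; this goes through invertibility and an extremal
  shift. The product of W and the inverse of W' is in general not Hermitian, so the sign of its
  eigenvalues is read off a generalized eigenvalue equation, and a triangular form links them to
  determinant and trace.\<close>

lemma adjoint_dim [simp]:
  "dim_row (A\<^sup>H) = dim_col A" "dim_col (A\<^sup>H) = dim_row A"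
  by (auto simp: mat_adjoint_def)

lemma adjoint_carrier [simp]: "A\<^sup>H \<in> carrier_mat n m \<longleftrightarrow> A \<in> carrier_mat m n"
  by (metis adjoint_dim carrier_matD carrier_matI)

lemma adjoint_index [simp]:
  "i < dim_col A \<Longrightarrow> j < dim_row A \<Longrightarrow> A\<^sup>H $$ (i, j) = conjugate (A $$ (j, i))"
  by (simp add: mat_adjoint_def mat_of_rows_index)

lemma conjugate_cnj [simp]: "conjugate (z :: complex) = cnj z"
  by (simp add: conjugate_complex_def)

lemma adjoint_adjoint [simp]: "(A\<^sup>H)\<^sup>H = (A :: complex mat)"
  by (rule eq_matI) auto

text \<open>Entries as plain finite sums, open to \<open>sum.swap\<close> and distributivity. The
  competing simp rule \<open>index_mult_mat(1)\<close> is deleted wherever this form is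
  wanted.\<close>

lemma index_mult_mat_sum:
  "i < dim_row A \<Longrightarrow> j < dim_col B \<Longrightarrow> dim_col A = dim_row B \<Longrightarrow>
    (A * B) $$ (i, j) = (\<Sum>k<dim_row B. A $$ (i, k) * B $$ (k, j))"
  by (simp add: scalar_prod_def lessThan_atLeast0)

text \<open>Multiplication laws guarded by dimensions rather than carriers, so that they can be
  used as rewrite rules without fixing sizes.\<close>

lemma adjoint_mult:
  "dim_col A = dim_row B \<Longrightarrow> (A * B :: complex mat)\<^sup>H = B\<^sup>H * A\<^sup>H"
  by (rule eq_matI) (auto simp: index_mult_mat_sum mult.commute simp del: index_mult_mat(1))

lemma mult_assoc_dim:
  "dim_col A = dim_row B \<Longrightarrow> dim_col B = dim_row C \<Longrightarrow>
    (A * B) * C = A * (B * C :: complex mat)"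
  by (rule assoc_mult_mat[of _ "dim_row A" "dim_col A" _ "dim_col B" _ "dim_col C"])
    (auto intro!: carrier_matI)

lemma add_mult_dim:
  "dim_row A = dim_row B \<Longrightarrow> dim_col A = dim_col B \<Longrightarrow> dim_col B = dim_row C \<Longrightarrow>
    (A + B) * C = A * C + B * (C :: complex mat)"
  by (rule add_mult_distrib_mat[of _ "dim_row A" "dim_col A"]) (auto intro!: carrier_matI)

lemma mult_add_dim:
  "dim_row B = dim_row C \<Longrightarrow> dim_col B = dim_col C \<Longrightarrow> dim_col A = dim_row B \<Longrightarrow>
    A * (B + C) = A * B + A * (C :: complex mat)"
  by (rule mult_add_distrib_mat[of _ "dim_row A" "dim_col A" _ "dim_col B"])
    (auto intro!: carrier_matI)

lemma minus_mult_dim: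
  "dim_row A = dim_row B \<Longrightarrow> dim_col A = dim_col B \<Longrightarrow> dim_col B = dim_row C \<Longrightarrow>
    (A - B) * C = A * C - B * (C :: complex mat)"
  by (rule minus_mult_distrib_mat[of _ "dim_row A" "dim_col A"]) (auto intro!: carrier_matI)

lemma mult_minus_dim:
  "dim_row B = dim_row C \<Longrightarrow> dim_col B = dim_col C \<Longrightarrow> dim_col A = dim_row B \<Longrightarrow>
    A * (B - C) = A * B - A * (C :: complex mat)"
  by (rule mult_minus_distrib_mat[of _ "dim_row A" "dim_col A" _ "dim_col B"])
    (auto intro!: carrier_matI)

lemma rscale_dim [simp]: "dim_row (rscale c A) = dim_row A" "dim_col (rscale c A) = dim_col A"
  by (auto simp: rscale_def)

lemma rscale_mult:
  "dim_col A = dim_row B \<Longrightarrow> rscale c A * B = rscale c (A * B)"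
  by (rule eq_matI) (auto simp: rscale_def index_mult_mat_sum sum_distrib_left mult.assoc
      simp del: index_mult_mat(1))

lemma mult_rscale:
  "dim_col A = dim_row B \<Longrightarrow> A * rscale c B = rscale c (A * B)"
  by (rule eq_matI) (auto simp: rscale_def index_mult_mat_sum sum_distrib_left mult_ac
      simp del: index_mult_mat(1))

lemma adjoint_add:
  "dim_row A = dim_row B \<Longrightarrow> dim_col A = dim_col B \<Longrightarrow> (A + B :: complex mat)\<^sup>H = A\<^sup>H + B\<^sup>H"
  by (rule eq_matI) auto

lemma adjoint_minus:
  "dim_row A = dim_row B \<Longrightarrow> dim_col A = dim_col B \<Longrightarrow> (A - B :: complex mat)\<^sup>H = A\<^sup>H - B\<^sup>H"
  by (rule eq_matI) auto

lemma adjoint_rscale: "(rscale c A)\<^sup>H = rscale c (A\<^sup>H)"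
  by (rule eq_matI) (auto simp: rscale_def)

lemma adjoint_one: "(1\<^sub>m n :: complex mat)\<^sup>H = 1\<^sub>m n"
  by (rule eq_matI) auto

lemma one_mult_dim: "dim_row A = n \<Longrightarrow> 1\<^sub>m n * A = (A :: complex mat)"
  by auto

lemma mult_one_dim: "dim_col A = n \<Longrightarrow> A * 1\<^sub>m n = (A :: complex mat)"
  by auto

lemma mat_sum_dim [simp]: "dim_row (mat_sum nr nc F S) = nr" "dim_col (mat_sum nr nc F S) = nc"
  by (auto simp: mat_sum_def)

lemma mult_mat_sum:
  assumes "\<And>s. s \<in> S \<Longrightarrow> F s \<in> carrier_mat nr nc" "dim_col A = nr"
  shows "A * mat_sum nr nc F S = mat_sum (dim_row A) nc (\<lambda>s. A * F s) S"
proof (rule eq_matI)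
  fix i j assume ij: "i < dim_row (mat_sum (dim_row A) nc (\<lambda>s. A * F s) S)"
    "j < dim_col (mat_sum (dim_row A) nc (\<lambda>s. A * F s) S)"
  have "(A * mat_sum nr nc F S) $$ (i, j) = (\<Sum>k<nr. \<Sum>s\<in>S. A $$ (i, k) * F s $$ (k, j))"
    using ij assms by (simp add: index_mult_mat_sum mat_sum_def sum_distrib_left del: index_mult_mat(1))
  also have "\<dots> = (\<Sum>s\<in>S. (A * F s) $$ (i, j))"
    using ij assms by (subst sum.swap) (auto intro!: sum.cong simp: index_mult_mat_sum carrier_matD[OF assms(1)] simp del: index_mult_mat(1))
  finally show "(A * mat_sum nr nc F S) $$ (i, j) = mat_sum (dim_row A) nc (\<lambda>s. A * F s) S $$ (i, j)"
    using ij by (simp add: mat_sum_def)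
qed (auto simp: assms)

lemma mat_sum_mult:
  assumes "\<And>s. s \<in> S \<Longrightarrow> F s \<in> carrier_mat nr nc" "dim_row A = nc"
  shows "mat_sum nr nc F S * A = mat_sum nr (dim_col A) (\<lambda>s. F s * A) S"
proof (rule eq_matI)
  fix i j assume ij: "i < dim_row (mat_sum nr (dim_col A) (\<lambda>s. F s * A) S)"
    "j < dim_col (mat_sum nr (dim_col A) (\<lambda>s. F s * A) S)"
  have "(mat_sum nr nc F S * A) $$ (i, j) = (\<Sum>k<nc. \<Sum>s\<in>S. F s $$ (i, k) * A $$ (k, j))"
    using ij assms by (simp add: index_mult_mat_sum mat_sum_def sum_distrib_right del: index_mult_mat(1))
  also have "\<dots> = (\<Sum>s\<in>S. (F s * A) $$ (i, j))"
    using ij assms by (subst sum.swap) (auto intro!: sum.cong simp: index_mult_mat_sum carrier_matD[OF assms(1)] simp del: index_mult_mat(1))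
  finally show "(mat_sum nr nc F S * A) $$ (i, j) = mat_sum nr (dim_col A) (\<lambda>s. F s * A) S $$ (i, j)"
    using ij by (simp add: mat_sum_def)
qed (auto simp: assms)

lemma mat_sum_insert:
  assumes "finite S" "s \<notin> S" "F s \<in> carrier_mat nr nc"
  shows "mat_sum nr nc F (insert s S) = mat_sum nr nc F S + F s"
  using assms by (intro eq_matI) (auto simp: mat_sum_def)

lemma mat_sum_empty: "mat_sum nr nc F {} = 0\<^sub>m nr nc"
  by (intro eq_matI) (auto simp: mat_sum_def)


section \<open>Trace\<close>

definition mtrace :: "complex mat \<Rightarrow> complex" where
  "mtrace A = (\<Sum>i<dim_row A. A $$ (i, i))"

lemma mtrace_add:
  "dim_row A = dim_row B \<Longrightarrow> dim_col A = dim_col B \<Longrightarrow> dim_row B = dim_col B \<Longrightarrow>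
    mtrace (A + B) = mtrace A + mtrace B"
  by (simp add: mtrace_def sum.distrib)

lemma mtrace_minus:
  "dim_row A = dim_row B \<Longrightarrow> dim_col A = dim_col B \<Longrightarrow> dim_row B = dim_col B \<Longrightarrow>
    mtrace (A - B) = mtrace A - mtrace B"
  by (simp add: mtrace_def sum_subtractf)

lemma mtrace_rscale:
  "dim_row A = dim_col A \<Longrightarrow> mtrace (rscale c A) = of_real c * mtrace A"
  by (simp add: mtrace_def rscale_def sum_distrib_left)

lemma mtrace_mat_sum:
  assumes "\<And>s. s \<in> S \<Longrightarrow> F s \<in> carrier_mat n n"
  shows "mtrace (mat_sum n n F S) = (\<Sum>s\<in>S. mtrace (F s))"
proof -
  have "mtrace (mat_sum n n F S) = (\<Sum>s\<in>S. \<Sum>i<n. F s $$ (i, i))"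
    by (simp add: mtrace_def mat_sum_def sum.swap[of _ S])
  then show ?thesis using assms by (auto simp: mtrace_def intro!: sum.cong)
qed

lemma mtrace_adjoint: "dim_row A = dim_col A \<Longrightarrow> mtrace (A\<^sup>H) = cnj (mtrace A)"
  by (simp add: mtrace_def)

lemma mtrace_one: "mtrace (1\<^sub>m n) = of_nat n"
  by (simp add: mtrace_def)

lemma mtrace_mult_comm:
  assumes "dim_col A = dim_row B" "dim_col B = dim_row A"
  shows "mtrace (A * B) = mtrace (B * A)"
proof -
  have "mtrace (A * B) = (\<Sum>i<dim_row A. \<Sum>k<dim_row B. A $$ (i, k) * B $$ (k, i))"
    using assms by (simp add: mtrace_def index_mult_mat_sum del: index_mult_mat(1))
  also have "\<dots> = (\<Sum>k<dim_row B. \<Sum>i<dim_row A. B $$ (k, i) * A $$ (i, k))"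
    by (subst sum.swap) (simp add: mult.commute)
  also have "\<dots> = mtrace (B * A)"
    using assms by (simp add: mtrace_def index_mult_mat_sum del: index_mult_mat(1))
  finally show ?thesis .
qed

text \<open>Normal form: sums of right-nested products with adjoints pushed to the factors and real
  scalars pulled out. Later statements are bracketed to the right, as in
  \<open>X\<^sup>H * (A * X)\<close>, to match it.\<close>

lemmas mat_algebra = mult_assoc_dim add_mult_dim mult_add_dim minus_mult_dim mult_minus_dim
  rscale_mult mult_rscale adjoint_mult adjoint_add adjoint_minus adjoint_rscale adjoint_one
  one_mult_dim mult_one_dim
lemmas mtrace_algebra = mtrace_add mtrace_minus mtrace_rscale mtrace_one

section \<open>Frobenius norm and the real inner product given by the trace\<close>

lemma frob_norm_sq: "(frob_norm X)\<^sup>2 = (\<Sum>i<dim_row X. \<Sum>j<dim_col X. (cmod (X $$ (i, j)))\<^sup>2)"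
proof -
  have "(frob_norm X)\<^sup>2 = sum_mat (map_mat (\<lambda>z. (cmod z)\<^sup>2) X)"
    unfolding frob_norm_def by (rule real_sqrt_pow2) (auto simp: sum_mat_def intro!: sum_nonneg)
  then show ?thesis
    unfolding sum_mat_def by (auto simp: sum.cartesian_product lessThan_atLeast0 intro!: sum.cong)
qed

text \<open>Identifies \<open>Re (mtrace (X\<^sup>H * Z))\<close> as the real inner product that
  belongs to \<open>frob_norm\<close>.\<close>

lemma Re_mtrace_adjoint_mult_self: "Re (mtrace (X\<^sup>H * X)) = (frob_norm X)\<^sup>2"
proof -
  have "Re (cnj z * z) = (cmod z)\<^sup>2" for z
    by (simp add: cmod_power2 flip: power2_eq_square)
  then have "Re (mtrace (X\<^sup>H * X)) = (\<Sum>i<dim_col X. \<Sum>k<dim_row X. (cmod (X $$ (k, i)))\<^sup>2)"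
    by (simp add: mtrace_def index_mult_mat_sum del: index_mult_mat(1) complex_mult_cnj times_complex.sel)
  also have "\<dots> = (frob_norm X)\<^sup>2"
    unfolding frob_norm_sq by (rule sum.swap)
  finally show ?thesis .
qed

lemma frob_norm_nonneg: "0 \<le> frob_norm X"
  by (auto simp: frob_norm_def sum_mat_def intro!: sum_nonneg)

lemma re_mtrace_swap:
  assumes "dim_row X = dim_row Z" "dim_col X = dim_col Z"
  shows "Re (mtrace (Z\<^sup>H * X)) = Re (mtrace (X\<^sup>H * Z))"
proof -
  have "mtrace (Z\<^sup>H * X) = mtrace ((X\<^sup>H * Z)\<^sup>H)"
    using assms by (simp add: mat_algebra)
  then show ?thesis using assms by (simp add: mtrace_adjoint)
qed

lemma frob_Cauchy_Schwarz:
  assumes "dim_row X = dim_row Z" "dim_col X = dim_col Z"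
  shows "Re (mtrace (X\<^sup>H * Z)) \<le> frob_norm X * frob_norm Z"
proof -
  let ?I = "{0..<dim_row Z} \<times> {0..<dim_col Z}"
  have X: "X \<in> carrier_mat (dim_row Z) (dim_col Z)" using assms by (rule carrier_matI)
  have "Re (mtrace (X\<^sup>H * Z)) = (\<Sum>j<dim_col Z. \<Sum>i<dim_row Z. Re (cnj (X $$ (i, j)) * Z $$ (i, j)))"
    using assms by (simp add: mtrace_def index_mult_mat_sum del: index_mult_mat(1))
  also have "\<dots> = (\<Sum>ij\<in>?I. Re (cnj (X $$ ij) * Z $$ ij))"
    by (subst sum.swap) (auto simp: sum.cartesian_product lessThan_atLeast0 simp del: times_complex.sel intro!: sum.cong)
  also have "\<dots> \<le> (\<Sum>ij\<in>?I. \<bar>cmod (X $$ ij)\<bar> * \<bar>cmod (Z $$ ij)\<bar>)"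
    by (intro sum_mono order.trans[OF complex_Re_le_cmod]) (simp add: norm_mult)
  also have "\<dots> \<le> L2_set (\<lambda>ij. cmod (X $$ ij)) ?I * L2_set (\<lambda>ij. cmod (Z $$ ij)) ?I"
    by (rule L2_set_mult_ineq)
  also have "\<dots> = frob_norm X * frob_norm Z"
    unfolding frob_norm_L2[OF X] frob_norm_L2[OF carrier_mat_triv[of Z]] ..
  finally show ?thesis .
qed

text \<open>Cauchy-Schwarz for each entry, row against column. The Frobenius norm thereby serves as
  a crude substitute for the operator norm.\<close>

lemma frob_norm_mult_le:
  assumes "dim_col A = dim_row X"
  shows "frob_norm (A * X) \<le> frob_norm A * frob_norm X"
proof -
  let ?K = "{..<dim_row X}"
  have "(cmod ((A * X) $$ (i, j)))\<^sup>2
      \<le> (\<Sum>k\<in>?K. (cmod (A $$ (i, k)))\<^sup>2) * (\<Sum>k\<in>?K. (cmod (X $$ (k, j)))\<^sup>2)"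
    if "i < dim_row A" "j < dim_col X" for i j
  proof -
    have "cmod ((A * X) $$ (i, j)) \<le> (\<Sum>k\<in>?K. \<bar>cmod (A $$ (i, k))\<bar> * \<bar>cmod (X $$ (k, j))\<bar>)"
      using that assms
      by (auto simp: index_mult_mat_sum norm_mult intro!: sum_norm_le simp del: index_mult_mat(1))
    also have "\<dots> \<le> L2_set (\<lambda>k. cmod (A $$ (i, k))) ?K * L2_set (\<lambda>k. cmod (X $$ (k, j))) ?K"
      by (rule L2_set_mult_ineq)
    finally have "(cmod ((A * X) $$ (i, j)))\<^sup>2
        \<le> (L2_set (\<lambda>k. cmod (A $$ (i, k))) ?K * L2_set (\<lambda>k. cmod (X $$ (k, j))) ?K)\<^sup>2"
      by (rule power_mono) simp
    then show ?thesis
      by (simp add: L2_set_def power_mult_distrib sum_nonneg)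
  qed
  then have "(frob_norm (A * X))\<^sup>2 \<le> (\<Sum>i<dim_row A. \<Sum>j<dim_col X.
      (\<Sum>k\<in>?K. (cmod (A $$ (i, k)))\<^sup>2) * (\<Sum>k\<in>?K. (cmod (X $$ (k, j)))\<^sup>2))"
    unfolding frob_norm_sq by (simp del: index_mult_mat(1)) (intro sum_mono, simp del: index_mult_mat(1))
  also have "\<dots> = (\<Sum>i<dim_row A. \<Sum>k\<in>?K. (cmod (A $$ (i, k)))\<^sup>2)
      * (\<Sum>j<dim_col X. \<Sum>k\<in>?K. (cmod (X $$ (k, j)))\<^sup>2)"
    by (simp add: sum_product)
  also have "\<dots> = (frob_norm A * frob_norm X)\<^sup>2"
    unfolding power_mult_distrib frob_norm_sq by (subst sum.swap[of _ "{..<dim_col X}"]) (simp add: assms)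
  finally show ?thesis
    by (rule power2_le_imp_le) (simp add: frob_norm_nonneg)
qed

section \<open>Positive matrices\<close>

lemma mat_inv:
  assumes A: "A \<in> carrier_mat n n" and "det A \<noteq> 0"
  shows "mat_inv A \<in> carrier_mat n n" "A * mat_inv A = 1\<^sub>m n" "mat_inv A * A = 1\<^sub>m n"
proof -
  \<comment> \<open>The parameter \<open>b\<close> is the extension field of the matrix ring record;
    fixing it makes the two facts speak of the same units.\<close>
  have "mat_inverse A \<noteq> None"
    using mat_inverse(1)[OF A, where b = "()"] det_non_zero_imp_unit[OF assms, where b = "()"] by blast
  then have "mat_inverse A = Some (mat_inv A)" by (simp add: mat_inv_def)
  from mat_inverse(2)[OF A this]
  show "mat_inv A \<in> carrier_mat n n" "A * mat_inv A = 1\<^sub>m n" "mat_inv A * A = 1\<^sub>m n" by auto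
qed

section \<open>Quadratic forms and the largest eigenvalue\<close>

lemma abs_quadratic_le:
  assumes A: "A \<in> carrier_mat n n" and X: "X \<in> carrier_mat n m"
  shows "\<bar>Re (mtrace (X\<^sup>H * (A * X)))\<bar> \<le> frob_norm A * (frob_norm X)\<^sup>2"
proof -
  have dims [simp]: "dim_row A = n" "dim_col A = n" "dim_row X = n" "dim_col X = m"
    using A X by auto
  have "frob_norm X * frob_norm (A * X) \<le> frob_norm X * (frob_norm A * frob_norm X)"
    by (intro mult_left_mono frob_norm_mult_le frob_norm_nonneg) simp
  then have le: "frob_norm X * frob_norm (A * X) \<le> frob_norm A * (frob_norm X)\<^sup>2"
    by (simp add: power2_eq_square mult_ac)
  have "Re (mtrace (X\<^sup>H * (A * X))) \<le> frob_norm X * frob_norm (A * X)"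
    by (rule frob_Cauchy_Schwarz) simp_all
  moreover have "Re (mtrace (X\<^sup>H * rscale (-1) (A * X))) \<le> frob_norm X * frob_norm (rscale (-1) (A * X))"
    by (rule frob_Cauchy_Schwarz) simp_all
  then have "- Re (mtrace (X\<^sup>H * (A * X))) \<le> frob_norm X * frob_norm (A * X)"
    by (simp add: mat_algebra mtrace_algebra frob_norm_rscale)
  ultimately show ?thesis using le by linarith
qed

text \<open>Let \<open>t\<close> be the least nonnegative shift for which \<open>B + t I\<close> is positive semidefinite.
  If \<open>t > 0\<close>, then \<open>-t\<close> is not an eigenvalue, so \<open>B + t I\<close> is invertible, hence bounded
  below, and a smaller shift suffices.\<close>

lemma hermitian_quadratic_nonneg:
  assumes B: "B \<in> carrier_mat n n" and herm: "B\<^sup>H = B"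
    and ev: "\<And>x. eigenvalue B (complex_of_real x) \<Longrightarrow> 0 \<le> x"
    and X: "X \<in> carrier_mat n m"
  shows "0 \<le> Re (mtrace (X\<^sup>H * (B * X)))"
proof -
  define S where "S = {t. 0 \<le> t \<and>
    (\<forall>m. \<forall>X\<in>carrier_mat n m. 0 \<le> Re (mtrace (X\<^sup>H * (B * X))) + t * (frob_norm X)\<^sup>2)}"
  define t where "t = Inf S"
  have "frob_norm B \<in> S"
    using abs_quadratic_le[OF B] by (force simp: S_def frob_norm_nonneg abs_le_iff)
  then have ne: "S \<noteq> {}" by blast
  have bdd: "bdd_below S" by (auto simp: S_def intro!: bdd_belowI[of _ 0])
  have t0: "0 \<le> t" unfolding t_def by (rule cInf_greatest[OF ne]) (auto simp: S_def)
  \<comment> \<open>The infimum is attained: each \<open>X\<close> of nonzero norm restricts the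
    shift to a closed half-line, and for norm zero the shift drops out.\<close>
  have tS: "0 \<le> Re (mtrace (X\<^sup>H * (B * X))) + t * (frob_norm X)\<^sup>2" if X: "X \<in> carrier_mat n m" for X m
  proof (cases "frob_norm X = 0")
    case True
    then show ?thesis using ne X by (force simp: S_def)
  next
    case False
    then have pos: "(frob_norm X)\<^sup>2 > 0" by simp
    have "- Re (mtrace (X\<^sup>H * (B * X))) / (frob_norm X)\<^sup>2 \<le> t"
      unfolding t_def
    proof (rule cInf_greatest[OF ne])
      fix s assume "s \<in> S"
      then have "0 \<le> Re (mtrace (X\<^sup>H * (B * X))) + s * (frob_norm X)\<^sup>2"
        using X by (auto simp: S_def)
      then show "- Re (mtrace (X\<^sup>H * (B * X))) / (frob_norm X)\<^sup>2 \<le> s"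
        by (subst pos_divide_le_eq[OF pos]) simp
    qed
    then show ?thesis unfolding pos_divide_le_eq[OF pos] by simp
  qed
  have "t = 0"
  proof (rule ccontr)
    assume "t \<noteq> 0"
    then have tpos: "t > 0" using t0 by simp
    define C where "C = B + rscale t (1\<^sub>m n)"
    have C: "C \<in> carrier_mat n n" using B by (simp add: C_def rscale_def)
    have dims [simp]: "dim_row B = n" "dim_col B = n" "dim_row C = n" "dim_col C = n"
      using B C by auto
    have hC: "C\<^sup>H = C" by (simp add: C_def mat_algebra herm)
    have "\<not> eigenvalue B (complex_of_real (- t))" using ev[of "- t"] tpos by auto
    moreover have "char_matrix B (complex_of_real (- t)) = C"
      by (simp add: char_matrix_def C_def rscale_def)
    ultimately have "det C \<noteq> 0" using eigenvalue_det[OF B] by simp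
    define K where "K = mat_inv C"
    have K: "K \<in> carrier_mat n n" "K * C = 1\<^sub>m n"
      unfolding K_def by (rule mat_inv[OF C \<open>det C \<noteq> 0\<close>])+
    \<comment> \<open>The added 1 only keeps both constants positive, since they occur as
      divisors.\<close>
    define c where "c = frob_norm C + 1"
    define \<kappa> where "\<kappa> = frob_norm K + 1"
    have c: "c > 0" and \<kappa>: "\<kappa> > 0" using frob_norm_nonneg[of C] frob_norm_nonneg[of K]
      by (auto simp: c_def \<kappa>_def)
    have QC: "Re (mtrace (X\<^sup>H * (C * X))) = Re (mtrace (X\<^sup>H * (B * X))) + t * (frob_norm X)\<^sup>2"
      if "X \<in> carrier_mat n m" for X m
      using that by (simp add: C_def mat_algebra mtrace_algebra Re_mtrace_adjoint_mult_self)
    have lower: "(frob_norm X)\<^sup>2 / (c * \<kappa>\<^sup>2) \<le> Re (mtrace (X\<^sup>H * (C * X)))"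
      if X: "X \<in> carrier_mat n m" for X m
    proof -
      have dX [simp]: "dim_row X = n" "dim_col X = m" using X by auto
      define Z where "Z = C * X"
      have dZ [simp]: "dim_row Z = n" "dim_col Z = m" by (simp_all add: Z_def)
      have Z: "Z \<in> carrier_mat n m" by (simp add: carrier_matI)
      have "K * Z = (K * C) * X" using K(1) by (simp add: Z_def mat_algebra)
      then have "X = K * Z" using K(2) X by simp
      then have "frob_norm X \<le> frob_norm K * frob_norm Z"
        using frob_norm_mult_le[of K Z] K by simp
      also have "\<dots> \<le> \<kappa> * frob_norm Z"
        by (rule mult_right_mono) (auto simp: \<kappa>_def frob_norm_nonneg)
      finally have XZ: "(frob_norm X)\<^sup>2 \<le> \<kappa>\<^sup>2 * (frob_norm Z)\<^sup>2"
        using power_mono[OF _ frob_norm_nonneg] by (metis power_mult_distrib)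
      have "Re (mtrace (Z\<^sup>H * (C * Z))) \<le> frob_norm C * (frob_norm Z)\<^sup>2"
        using abs_quadratic_le[OF C Z] by linarith
      also have "\<dots> \<le> c * (frob_norm Z)\<^sup>2"
        by (rule mult_right_mono) (auto simp: c_def)
      finally have QZ: "Re (mtrace (Z\<^sup>H * (C * Z))) \<le> c * (frob_norm Z)\<^sup>2" .
      have XCZ: "mtrace (X\<^sup>H * (C * Z)) = mtrace (Z\<^sup>H * Z)"
        by (simp add: Z_def mat_algebra hC)
      have ZCX: "mtrace (Z\<^sup>H * (C * X)) = mtrace (Z\<^sup>H * Z)"
        by (simp add: Z_def)
      \<comment> \<open>A step of length \<open>1 / c\<close> along \<open>Z = C * X\<close>. The
        form of \<open>C\<close> is nonnegative at \<open>?D\<close> and at most \<open>c\<close>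
        times the squared norm at \<open>Z\<close>, so expanding yields
        \<open>(frob_norm Z)\<^sup>2 / c\<close> as a lower bound at \<open>X\<close>. Invertibility
        then bounds \<open>Z\<close> below by \<open>X\<close>.\<close>
      let ?D = "X - rscale (1 / c) Z"
      have D: "?D \<in> carrier_mat n m" by (simp add: carrier_matI)
      have "0 \<le> Re (mtrace (?D\<^sup>H * (C * ?D)))" using tS[OF D] QC[OF D] by simp
      also have "\<dots> = Re (mtrace (X\<^sup>H * (C * X))) - 2 * (1 / c) * (frob_norm Z)\<^sup>2
          + (1 / c)\<^sup>2 * Re (mtrace (Z\<^sup>H * (C * Z)))"
        by (simp add: mat_algebra mtrace_algebra XCZ ZCX Re_mtrace_adjoint_mult_self power2_eq_square algebra_simps)
      also have "(1 / c)\<^sup>2 * Re (mtrace (Z\<^sup>H * (C * Z))) \<le> (1 / c)\<^sup>2 * (c * (frob_norm Z)\<^sup>2)"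
        by (rule mult_left_mono[OF QZ]) simp
      also have "(1 / c)\<^sup>2 * (c * (frob_norm Z)\<^sup>2) = (1 / c) * (frob_norm Z)\<^sup>2"
        using c by (simp add: power2_eq_square)
      finally have "(1 / c) * (frob_norm Z)\<^sup>2 \<le> Re (mtrace (X\<^sup>H * (C * X)))" by simp
      moreover have "(frob_norm X)\<^sup>2 / (c * \<kappa>\<^sup>2) \<le> (1 / c) * (frob_norm Z)\<^sup>2"
        using XZ c \<kappa> by (simp add: field_simps)
      ultimately show ?thesis by linarith
    qed
    \<comment> \<open>The first argument of \<open>min\<close> keeps the smaller shift
      \<open>t - e\<close> nonnegative, as membership in \<open>S\<close> demands.\<close>
    define e where "e = min t (1 / (c * \<kappa>\<^sup>2))"
    have e: "0 < e" "e \<le> t" using tpos c \<kappa> by (auto simp: e_def)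
    have "t - e \<in> S"
      unfolding S_def
    proof (safe)
      fix m and X :: "complex mat" assume X: "X \<in> carrier_mat n m"
      have "e * (frob_norm X)\<^sup>2 \<le> (1 / (c * \<kappa>\<^sup>2)) * (frob_norm X)\<^sup>2"
        by (rule mult_right_mono) (auto simp: e_def)
      then show "0 \<le> Re (mtrace (X\<^sup>H * (B * X))) + (t - e) * (frob_norm X)\<^sup>2"
        using lower[OF X] QC[OF X] by (simp add: algebra_simps)
    qed (use e in simp)
    then have "t \<le> t - e" unfolding t_def by (rule cInf_lower[OF _ bdd])
    then show False using e by simp
  qed
  then show ?thesis using tS[OF X] by simp
qed

text \<open>Makes the \<open>Max\<close> in \<open>lambda_max\<close> an upper bound for every real
  eigenvalue.\<close>

lemma finite_real_eigenvalues:
  assumes A: "A \<in> carrier_mat n n"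
  shows "finite {x. eigenvalue A (complex_of_real x)}"
proof -
  have "char_poly A \<noteq> 0" using degree_monic_char_poly[OF A] by auto
  then have "finite {z. poly (char_poly A) z = 0}" by (rule poly_roots_finite)
  then have "finite (complex_of_real -` {z. poly (char_poly A) z = 0})"
    by (rule finite_vimageI) (auto simp: inj_on_def)
  then show ?thesis by (simp add: eigenvalue_root_char_poly[OF A] vimage_def)
qed

text \<open>An eigenvalue \<open>x\<close> of \<open>lam I - L\<close> corresponds to the eigenvalue
  \<open>lam - x\<close> of \<open>L\<close>, hence is nonnegative. For \<open>n = 0\<close> there
  are no eigenvalues and this holds vacuously.\<close>

lemma quadratic_le_lambda_max:
  assumes L: "L \<in> carrier_mat n n" and herm: "L\<^sup>H = L" and lam: "lambda_max L \<le> lam"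
    and X: "X \<in> carrier_mat n m"
  shows "Re (mtrace (X\<^sup>H * (L * X))) \<le> lam * (frob_norm X)\<^sup>2"
proof -
  define B where "B = rscale lam (1\<^sub>m n) - L"
  have dims [simp]: "dim_row L = n" "dim_col L = n" "dim_row X = n" "dim_col X = m"
    using L X by auto
  have B: "B \<in> carrier_mat n n" using L by (simp add: B_def minus_carrier_mat)
  have hB: "B\<^sup>H = B" by (simp add: B_def mat_algebra herm)
  have "0 \<le> x" if "eigenvalue B (complex_of_real x)" for x
  proof -
    have "char_matrix B (complex_of_real x) = - char_matrix L (complex_of_real (lam - x))"
      by (rule eq_matI) (auto simp: char_matrix_def B_def rscale_def)
    then have "eigenvalue L (complex_of_real (lam - x))"
      using that det_0_negate[of "char_matrix L (complex_of_real (lam - x))" n]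
      unfolding eigenvalue_det[OF B] eigenvalue_det[OF L] by (simp add: char_matrix_def)
    then have "lam - x \<le> lambda_max L"
      unfolding lambda_max_def by (intro Max_ge finite_real_eigenvalues[OF L]) simp
    then show ?thesis using lam by simp
  qed
  from hermitian_quadratic_nonneg[OF B hB this X]
  show ?thesis
    by (simp add: B_def mat_algebra mtrace_algebra Re_mtrace_adjoint_mult_self)
qed

text \<open>The cone of sums of matrices \<open>B * B\<^sup>H\<close>. All positive semidefinite matrices of the problem are
  given in this form, so no square roots are needed.\<close>

inductive gram :: "nat \<Rightarrow> complex mat \<Rightarrow> bool" for n where
  gram_zero: "gram n (0\<^sub>m n n)"
| gram_step: "gram n A \<Longrightarrow> B \<in> carrier_mat n m \<Longrightarrow> gram n (A + B * B\<^sup>H)"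

lemma gram_carrier: "gram n A \<Longrightarrow> A \<in> carrier_mat n n"
  by (induction rule: gram.induct) auto

lemma gram_dim: "gram n A \<Longrightarrow> dim_row A = n" "gram n A \<Longrightarrow> dim_col A = n"
  using gram_carrier by blast+

lemma gram_hermitian: "gram n A \<Longrightarrow> A\<^sup>H = A"
proof (induction rule: gram.induct)
  case gram_zero
  then show ?case by (intro eq_matI) auto
qed (simp add: mat_algebra gram_dim)

lemma gram_mult_adjoint: "B \<in> carrier_mat n m \<Longrightarrow> gram n (B * B\<^sup>H)"
  using gram_step[OF gram_zero, of B n m] by simp

lemma gram_add: "gram n B \<Longrightarrow> gram n A \<Longrightarrow> gram n (A + B)"
proof (induction rule: gram.induct)
  case gram_zero
  then show ?case using gram_carrier by simp
next
  case (gram_step B C m)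
  then have "A + (B + C * C\<^sup>H) = (A + B) + C * C\<^sup>H"
    using gram_carrier by (intro assoc_add_mat[symmetric, of _ n n]) auto
  then show ?case using gram_step gram.gram_step by metis
qed

lemma gram_congruence: "gram n A \<Longrightarrow> C \<in> carrier_mat k n \<Longrightarrow> gram k (C * (A * C\<^sup>H))"
proof (induction rule: gram.induct)
  case gram_zero
  then have "C * (0\<^sub>m n n * C\<^sup>H) = 0\<^sub>m k k" by simp
  then show ?case by (simp add: gram.gram_zero)
next
  case (gram_step A B m)
  then have "C * ((A + B * B\<^sup>H) * C\<^sup>H) = C * (A * C\<^sup>H) + (C * B) * (C * B)\<^sup>H"
    by (simp add: mat_algebra gram_dim)
  moreover have "C * B \<in> carrier_mat k m" using gram_step by simp
  ultimately show ?case using gram_step gram.gram_step by metis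
qed

lemma gram_one: "gram n (1\<^sub>m n)"
  using gram_mult_adjoint[of "1\<^sub>m n" n n] by (simp add: adjoint_one)

lemma gram_rscale: "gram n A \<Longrightarrow> 0 \<le> c \<Longrightarrow> gram n (rscale c A)"
proof -
  assume A: "gram n A" and c: "0 \<le> c"
  \<comment> \<open>Scaling by \<open>c\<close> is congruence with the square root of
    \<open>c\<close> times the identity.\<close>
  let ?C = "rscale (sqrt c) (1\<^sub>m n)"
  have "gram n (?C * (A * ?C\<^sup>H))" by (rule gram_congruence[OF A]) (simp add: carrier_matI)
  moreover have "rscale (sqrt c) (rscale (sqrt c) A) = rscale c A"
    using c by (intro eq_matI) (auto simp: rscale_def simp flip: of_real_mult mult.assoc)
  then have "?C * (A * ?C\<^sup>H) = rscale c A"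
    using gram_dim[OF A] by (simp add: mat_algebra)
  ultimately show ?thesis by simp
qed

lemma gram_mat_sum: "finite S \<Longrightarrow> (\<And>s. s \<in> S \<Longrightarrow> gram n (F s)) \<Longrightarrow> gram n (mat_sum n n F S)"
proof (induction rule: finite_induct)
  case empty
  then show ?case by (simp add: mat_sum_empty gram_zero)
next
  case (insert s S)
  then show ?case by (simp add: mat_sum_insert gram_carrier gram_add)
qed

lemma gram_quadratic_nonneg:
  "gram n A \<Longrightarrow> X \<in> carrier_mat n m \<Longrightarrow> 0 \<le> Re (mtrace (X\<^sup>H * (A * X)))"
proof (induction rule: gram.induct)
  case gram_zero
  then show ?case by (simp add: mtrace_def)
next
  case (gram_step A B k)
  have "mtrace (X\<^sup>H * ((A + B * B\<^sup>H) * X)) = mtrace (X\<^sup>H * (A * X)) + mtrace ((B\<^sup>H * X)\<^sup>H * (B\<^sup>H * X))"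
    using gram_step by (simp add: mat_algebra gram_dim mtrace_algebra)
  then show ?case using gram_step by (simp add: Re_mtrace_adjoint_mult_self)
qed

text \<open>Peeling \<open>P\<close> into summands \<open>B * B\<^sup>H\<close> and moving
  \<open>B\<^sup>H\<close> around the trace leaves quadratic forms of \<open>A\<close>.\<close>

lemma gram_trace_nonneg:
  assumes "gram n P" "gram n A" shows "0 \<le> Re (mtrace (A * P))"
  using assms(1)
proof (induction rule: gram.induct)
  case gram_zero
  then show ?case using assms(2) gram_carrier by (simp add: mtrace_def gram_dim)
next
  case (gram_step P B m)
  then have "mtrace (A * (B * B\<^sup>H)) = mtrace (B\<^sup>H * (A * B))"
    using mtrace_mult_comm[of "A * B" "B\<^sup>H"] gram_dim[OF assms(2)] by (simp add: mat_algebra)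
  moreover have "0 \<le> Re (mtrace (B\<^sup>H * (A * B)))"
    using gram_quadratic_nonneg[OF assms(2)] gram_step by blast
  ultimately show ?case
    using gram_step gram_dim[OF assms(2)] by (simp add: mat_algebra mtrace_algebra gram_dim)
qed

text \<open>Cone membership supplies the Hermitian property. Strictness is tested on single columns,
  the shape in which eigenvectors arrive.\<close>

definition posdef :: "nat \<Rightarrow> complex mat \<Rightarrow> bool" where
  "posdef n A \<longleftrightarrow> gram n A \<and>
    (\<forall>v\<in>carrier_mat n 1. v \<noteq> 0\<^sub>m n 1 \<longrightarrow> 0 < Re (mtrace (v\<^sup>H * (A * v))))"

text \<open>In the application \<open>c\<close> is the noise power, which makes every interference
  covariance invertible.\<close>

lemma posdefI:
  assumes A: "gram n A" and c: "0 < c"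
  shows "posdef n (A + rscale c (1\<^sub>m n))"
  unfolding posdef_def
proof (intro conjI ballI impI)
  show "gram n (A + rscale c (1\<^sub>m n))"
    using assms by (intro gram_add gram_rscale gram_one) auto
  fix v :: "complex mat" assume v: "v \<in> carrier_mat n 1" "v \<noteq> 0\<^sub>m n 1"
  have "frob_norm v \<noteq> 0"
  proof
    assume "frob_norm v = 0"
    then have "cmod (v $$ ij) = 0" if "ij \<in> {0..<n} \<times> {0..<1}" for ij
      unfolding frob_norm_L2[OF v(1)] using that by (subst (asm) L2_set_eq_0_iff) auto
    then have "v = 0\<^sub>m n 1" using v(1) by (intro eq_matI) auto
    then show False using v(2) by simp
  qed
  then have "0 < c * (frob_norm v)\<^sup>2" using c by simp
  then show "0 < Re (mtrace (v\<^sup>H * ((A + rscale c (1\<^sub>m n)) * v)))"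
    using gram_quadratic_nonneg[OF A v(1)] v(1)
    by (simp add: mat_algebra gram_dim[OF A] mtrace_algebra Re_mtrace_adjoint_mult_self)
qed

section \<open>Eigenvalues, determinant and trace\<close>

lemma eigenvalue_column:
  assumes A: "A \<in> carrier_mat n n" and "eigenvalue A \<mu>"
  obtains X where "X \<in> carrier_mat n 1" "X \<noteq> 0\<^sub>m n 1" "A * X = \<mu> \<cdot>\<^sub>m X"
proof -
  obtain v where v: "v \<in> carrier_vec n" "v \<noteq> 0\<^sub>v n" "A *\<^sub>v v = \<mu> \<cdot>\<^sub>v v"
    using assms by (auto simp: eigenvalue_def eigenvector_def)
  define X where "X = mat n 1 (\<lambda>(i, j). v $ i)"
  have X: "X \<in> carrier_mat n 1" by (simp add: X_def)
  have "col X 0 = v" using v(1) by (intro eq_vecI) (auto simp: X_def)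
  have "X \<noteq> 0\<^sub>m n 1"
  proof
    assume "X = 0\<^sub>m n 1"
    then have "col X 0 = 0\<^sub>v n" by (intro eq_vecI) auto
    then show False using \<open>col X 0 = v\<close> v(2) by simp
  qed
  moreover have "A * X = \<mu> \<cdot>\<^sub>m X"
  proof (rule eq_matI)
    fix i j assume "i < dim_row (\<mu> \<cdot>\<^sub>m X)" "j < dim_col (\<mu> \<cdot>\<^sub>m X)"
    then have ij: "i < n" "j = 0" by (auto simp: X_def)
    have "(A *\<^sub>v v) $ i = row A i \<bullet> v" using A ij by simp
    then show "(A * X) $$ (i, j) = (\<mu> \<cdot>\<^sub>m X) $$ (i, j)"
      using v ij A X \<open>col X 0 = v\<close> by (simp add: X_def)
  qed (use A X in auto)
  ultimately show ?thesis using X that by blast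
qed

lemma mtrace_mult_smult:
  "dim_col A = dim_row B \<Longrightarrow> dim_col B = dim_row A \<Longrightarrow> mtrace (A * (c \<cdot>\<^sub>m B)) = c * mtrace (A * B)"
  by (simp add: mtrace_def index_mult_mat_sum sum_distrib_left mult_ac del: index_mult_mat(1))

lemma posdef_det_nonzero:
  assumes A: "posdef n A"
  shows "det A \<noteq> 0"
proof
  assume "det A = 0"
  have cA: "A \<in> carrier_mat n n" using A gram_carrier by (auto simp: posdef_def)
  have "char_matrix A 0 = A" using cA by (intro eq_matI) (auto simp: char_matrix_def)
  then have "eigenvalue A 0" using \<open>det A = 0\<close> eigenvalue_det[OF cA] by simp
  then obtain X where X: "X \<in> carrier_mat n 1" "X \<noteq> 0\<^sub>m n 1" "A * X = 0 \<cdot>\<^sub>m X"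
    by (rule eigenvalue_column[OF cA])
  have "mtrace (X\<^sup>H * (A * X)) = 0"
    unfolding X(3) using X(1) by (subst mtrace_mult_smult) auto
  then show False using A X unfolding posdef_def by fastforce
qed

text \<open>With \<open>U = mat_inv B * X\<close> an eigenvector equation becomes the generalized
  one, \<open>A * U = \<mu> \<cdot>\<^sub>m (B * U)\<close>. Pairing with \<open>U\<close> exhibits
  the eigenvalue as a quotient of two positive numbers; both forms are real because they equal their
  conjugates.\<close>

lemma posdef_quotient_eigenvalue:
  assumes A: "posdef n A" and B: "posdef n B" and "eigenvalue (A * mat_inv B) \<mu>"
  shows "\<exists>x>0. \<mu> = complex_of_real x"
proof -
  have cA: "A \<in> carrier_mat n n" and cB: "B \<in> carrier_mat n n"
    and hA: "A\<^sup>H = A" and hB: "B\<^sup>H = B"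
    using A B by (auto simp: posdef_def gram_carrier gram_hermitian)
  note I = mat_inv[OF cB posdef_det_nonzero[OF B]]
  have dims [simp]: "dim_row A = n" "dim_col A = n" "dim_row B = n" "dim_col B = n"
    "dim_row (mat_inv B) = n" "dim_col (mat_inv B) = n" using cA cB I by auto
  have "A * mat_inv B \<in> carrier_mat n n" using cA I by simp
  then obtain X where X: "X \<in> carrier_mat n 1" "X \<noteq> 0\<^sub>m n 1" "(A * mat_inv B) * X = \<mu> \<cdot>\<^sub>m X"
    using assms(3) by (rule eigenvalue_column)
  define U where "U = mat_inv B * X"
  have U: "U \<in> carrier_mat n 1" using I X by (simp add: U_def)
  have dX [simp]: "dim_row X = n" "dim_col X = 1" "dim_row U = n" "dim_col U = 1" using X U by auto
  have "B * U = (B * mat_inv B) * X" by (simp add: U_def mat_algebra)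
  then have BU: "B * U = X" using I X by simp
  have "U \<noteq> 0\<^sub>m n 1" using BU X(2) cB by auto
  then have pos: "0 < Re (mtrace (U\<^sup>H * (A * U)))" "0 < Re (mtrace (U\<^sup>H * (B * U)))"
    using A B U by (auto simp: posdef_def)
  have "mtrace (U\<^sup>H * (A * U)) = cnj (mtrace (U\<^sup>H * (A * U)))"
    by (subst mtrace_adjoint[symmetric]) (simp_all add: mat_algebra hA)
  then have rA: "Im (mtrace (U\<^sup>H * (A * U))) = 0" by (metis complex_cnj_cancel_iff complex.sel(2) cnj.simps(2) neg_equal_zero)
  have "mtrace (U\<^sup>H * (B * U)) = cnj (mtrace (U\<^sup>H * (B * U)))"
    by (subst mtrace_adjoint[symmetric]) (simp_all add: mat_algebra hB)
  then have rB: "Im (mtrace (U\<^sup>H * (B * U))) = 0" by (metis complex_cnj_cancel_iff complex.sel(2) cnj.simps(2) neg_equal_zero)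
  have "A * U = \<mu> \<cdot>\<^sub>m (B * U)"
    using X(3) unfolding BU by (simp add: U_def mat_algebra)
  then have "mtrace (U\<^sup>H * (A * U)) = \<mu> * mtrace (U\<^sup>H * (B * U))"
    by (simp add: mtrace_mult_smult)
  moreover define a b where "a = Re (mtrace (U\<^sup>H * (A * U)))" and "b = Re (mtrace (U\<^sup>H * (B * U)))"
  ultimately have "complex_of_real a = \<mu> * complex_of_real b" "a > 0" "b > 0"
    using rA rB pos by (auto simp: complex_eq_iff)
  then have "\<mu> = complex_of_real (a / b)" "a / b > 0" by (auto simp: field_simps)
  then show ?thesis by blast
qed

lemma mtrace_similar:
  assumes "similar_mat A B"
  shows "mtrace A = mtrace B"
proof -
  obtain n P Q where c: "{A, B, P, Q} \<subseteq> carrier_mat n n"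
    and QP: "Q * P = 1\<^sub>m n" and AB: "A = P * B * Q"
    using similar_matD[OF assms] by blast
  have dims: "dim_row B = n" "dim_col B = n" "dim_row P = n" "dim_col P = n" "dim_row Q = n" "dim_col Q = n"
    using c by auto
  have "mtrace A = mtrace (Q * (P * B))" unfolding AB by (rule mtrace_mult_comm) (auto simp: dims)
  also have "Q * (P * B) = (Q * P) * B" by (simp add: mat_algebra dims)
  also have "\<dots> = B" unfolding QP by (simp add: dims)
  finally show ?thesis .
qed

lemma sum_list_diag_mat: "A \<in> carrier_mat n n \<Longrightarrow> sum_list (diag_mat A) = mtrace A"
  by (simp add: diag_mat_def mtrace_def sum_list_sum_nth lessThan_atLeast0)

text \<open>The list is the diagonal of a Schur triangular form, which exists for every complex
  square matrix and has the same determinant and trace.\<close>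

lemma det_trace_eigenvalues:
  assumes A: "A \<in> carrier_mat n n"
  obtains es where "length es = n" "\<And>e. e \<in> set es \<Longrightarrow> eigenvalue A e"
    "det A = prod_list es" "mtrace A = sum_list es"
proof -
  obtain as where as: "char_poly A = (\<Prod>a\<leftarrow>as. [:- a, 1:])" "length as = n"
    using char_poly_factorized[OF A] by blast
  obtain T where T: "T \<in> carrier_mat n n" "upper_triangular T" "similar_mat A T"
    using schur_decomposition_exists[OF A as(1)] by blast
  show ?thesis
  proof (rule that[of "diag_mat T"])
    show "length (diag_mat T) = n" using T by (simp add: diag_mat_def)
    show "det A = prod_list (diag_mat T)"
      using det_similar[OF T(3)] det_upper_triangular[OF T(2,1)] by simp
    show "mtrace A = sum_list (diag_mat T)"
      using mtrace_similar[OF T(3)] sum_list_diag_mat[OF T(1)] by simp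
    show "eigenvalue A e" if "e \<in> set (diag_mat T)" for e
      unfolding eigenvalue_root_char_poly[OF A] char_poly_similar[OF T(3)]
        char_poly_upper_triangular[OF T(1,2)] poly_prod_list
      using that by (auto simp: prod_list_zero_iff)
  qed
qed

lemma ln_prod_list_le:
  "(\<And>x. x \<in> set xs \<Longrightarrow> 0 < x) \<Longrightarrow>
    0 < prod_list xs \<and> ln (prod_list xs) \<le> sum_list xs - real (length xs)" for xs :: "real list"
proof (induction xs)
  case (Cons x xs)
  then have "0 < x" "0 < prod_list xs" "ln (prod_list xs) \<le> sum_list xs - real (length xs)" by auto
  then show ?case using ln_le_minus_one[of x] by (simp add: ln_mult_pos)
qed simp

lemma posdef_quotient_det:
  assumes A: "posdef n A" and B: "posdef n B"
  obtains d where "0 < d" "det (A * mat_inv B) = complex_of_real d"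
    "ln d \<le> Re (mtrace (A * mat_inv B)) - real n"
proof -
  have cA: "A \<in> carrier_mat n n" and cB: "B \<in> carrier_mat n n"
    using A B by (auto simp: posdef_def gram_carrier)
  have "A * mat_inv B \<in> carrier_mat n n" using cA mat_inv[OF cB posdef_det_nonzero[OF B]] by simp
  then obtain es where es: "length es = n" "\<And>e. e \<in> set es \<Longrightarrow> eigenvalue (A * mat_inv B) e"
    "det (A * mat_inv B) = prod_list es" "mtrace (A * mat_inv B) = sum_list es"
    by (rule det_trace_eigenvalues) blast
  have pos: "\<exists>x>0. e = complex_of_real x" if "e \<in> set es" for e
    using posdef_quotient_eigenvalue[OF A B es(2)[OF that]] .
  define xs where "xs = map Re es"
  have "map complex_of_real xs = es"
    unfolding xs_def map_map by (rule map_idI) (use pos in force)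
  moreover have "prod_list (map complex_of_real xs) = complex_of_real (prod_list xs)"
    "sum_list (map complex_of_real xs) = complex_of_real (sum_list xs)"
    by (induction xs) auto
  ultimately have "prod_list es = complex_of_real (prod_list xs)" "sum_list es = complex_of_real (sum_list xs)"
    by auto
  moreover have "0 < x" if "x \<in> set xs" for x using that pos by (force simp: xs_def)
  then have "0 < prod_list xs \<and> ln (prod_list xs) \<le> sum_list xs - real (length xs)"
    by (rule ln_prod_list_le)
  ultimately show ?thesis
    using es by (intro that[of "prod_list xs"]) (auto simp: xs_def)
qed

lemma posdef_one: "posdef n (1\<^sub>m n)"
proof -
  have "0\<^sub>m n n + rscale 1 (1\<^sub>m n) = 1\<^sub>m n" by (intro eq_matI) (auto simp: rscale_def)
  then show ?thesis using posdefI[OF gram_zero, of 1 n] by simp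
qed

lemma log_det_diff_le:
  assumes A: "posdef n A" and B: "posdef n B"
  shows "log_det A - log_det B \<le> Re (mtrace (A * mat_inv B)) - real n"
proof -
  \<comment> \<open>The quotient by the identity: each positive definite matrix has a positive real
    determinant, so \<open>log_det\<close> is a genuine logarithm.\<close>
  have det_real: "\<exists>a>0. det A = complex_of_real a" if "posdef n A" for A
  proof -
    have c: "A \<in> carrier_mat n n" using that by (auto simp: posdef_def gram_carrier)
    have "mat_inv (1\<^sub>m n) = 1\<^sub>m n"
      using mat_inv[of "1\<^sub>m n" n] by simp
    then have "A * mat_inv (1\<^sub>m n) = A" using c by simp
    then show ?thesis using posdef_quotient_det[OF that posdef_one] by metis
  qed
  obtain a b where a: "a > 0" "det A = complex_of_real a" and b: "b > 0" "det B = complex_of_real b"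
    using det_real[OF A] det_real[OF B] by blast
  obtain d where d: "0 < d" "det (A * mat_inv B) = complex_of_real d"
    "ln d \<le> Re (mtrace (A * mat_inv B)) - real n"
    by (rule posdef_quotient_det[OF A B])
  have cA: "A \<in> carrier_mat n n" and cB: "B \<in> carrier_mat n n"
    using A B by (auto simp: posdef_def gram_carrier)
  note I = mat_inv[OF cB posdef_det_nonzero[OF B]]
  have "det (A * mat_inv B) * det B = det ((A * mat_inv B) * B)"
    using cA cB I by (intro det_mult[symmetric, of _ n]) auto
  also have "(A * mat_inv B) * B = A * (mat_inv B * B)"
    using cA cB I(1) by (intro assoc_mult_mat)
  also have "\<dots> = A" using I cA by simp
  finally have "complex_of_real (d * b) = complex_of_real a" using a b d by simp
  then have "a = d * b" using of_real_eq_iff by metis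
  then have "ln a = ln d + ln b" using d b by (simp add: ln_mult)
  then show ?thesis using a b d by (simp add: log_det_def)
qed

lemma posdef_gram: "posdef n A \<Longrightarrow> gram n A"
  by (simp add: posdef_def)

lemma posdef_add_gram:
  assumes A: "posdef n A" and B: "gram n B"
  shows "posdef n (A + B)"
  unfolding posdef_def
proof (intro conjI ballI impI)
  show "gram n (A + B)" using posdef_gram[OF A] B by (rule gram_add[rotated])
  fix v :: "complex mat" assume v: "v \<in> carrier_mat n 1" "v \<noteq> 0\<^sub>m n 1"
  then have "0 < Re (mtrace (v\<^sup>H * (A * v)))" using A by (simp add: posdef_def)
  then show "0 < Re (mtrace (v\<^sup>H * ((A + B) * v)))"
    using gram_quadratic_nonneg[OF B v(1)] v(1) gram_dim[OF B] gram_dim[OF posdef_gram[OF A]]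
    by (simp add: mat_algebra mtrace_algebra)
qed

text \<open>The inverse \<open>K\<close> is Hermitian, so \<open>K = K * (A * K\<^sup>H)\<close>, a
  congruence of \<open>A\<close> itself.\<close>

lemma gram_mat_inv:
  assumes A: "gram n A" and "det A \<noteq> 0"
  shows "gram n (mat_inv A)"
proof -
  define K where "K = mat_inv A"
  note I = mat_inv[OF gram_carrier[OF A] assms(2), folded K_def]
  have dims [simp]: "dim_row A = n" "dim_col A = n" "dim_row K = n" "dim_col K = n"
    using gram_dim[OF A] I(1) by auto
  have "K\<^sup>H = K\<^sup>H * (A * K)" using I by (simp add: mat_algebra)
  also have "\<dots> = (A * K)\<^sup>H * K" by (simp add: mat_algebra gram_hermitian[OF A])
  also have "\<dots> = K" using I by (simp add: mat_algebra)
  finally have "K * (A * K\<^sup>H) = K * (A * K)" by simp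
  also have "\<dots> = K" using I by (simp add: mat_algebra)
  finally have "K * (A * K\<^sup>H) = K" .
  then show ?thesis using gram_congruence[OF A I(1)] by (simp add: K_def)
qed

section \<open>The surrogate of the log-determinant\<close>

text \<open>The matrix \<open>1 - Y\<^sup>H * X\<close> is the error covariance of the receiver \<open>Y\<close>.\<close>

lemma mmse_inverse:
  assumes X: "X \<in> carrier_mat r d" and M: "posdef r M"
  defines "J \<equiv> X * X\<^sup>H + M"
  defines "W \<equiv> 1\<^sub>m d + X\<^sup>H * (mat_inv M * X)"
  defines "Y \<equiv> mat_inv J * X"
  shows "gram r J" "posdef d W" "Y \<in> carrier_mat r d" "J * Y = X" "mat_inv W = 1\<^sub>m d - Y\<^sup>H * X"
proof -
  define K where "K = mat_inv M"
  have cM: "M \<in> carrier_mat r r" using M posdef_gram gram_carrier by blast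
  note I = mat_inv[OF cM posdef_det_nonzero[OF M], folded K_def]
  have gK: "gram r K"
    unfolding K_def by (rule gram_mat_inv[OF posdef_gram[OF M] posdef_det_nonzero[OF M]])
  have gXX: "gram r (X * X\<^sup>H)" by (rule gram_mult_adjoint[OF X])
  have "X * X\<^sup>H + M = M + X * X\<^sup>H"
    using gram_carrier[OF gXX] cM by (rule comm_add_mat)
  then have J: "posdef r J" using posdef_add_gram[OF M gXX] by (simp add: J_def)
  then show "gram r J" by (rule posdef_gram)
  have "gram d (X\<^sup>H * (K * X))"
    using gram_congruence[OF gK, of "X\<^sup>H" d] X by simp
  then show W: "posdef d W"
    unfolding W_def K_def[symmetric] by (rule posdef_add_gram[OF posdef_one])
  have cJ: "J \<in> carrier_mat r r" using J posdef_gram gram_carrier by blast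
  have cW: "W \<in> carrier_mat d d" using W posdef_gram gram_carrier by blast
  note IJ = mat_inv[OF cJ posdef_det_nonzero[OF J]]
  note IW = mat_inv[OF cW posdef_det_nonzero[OF W]]
  show Y: "Y \<in> carrier_mat r d" using IJ X by (simp add: Y_def)
  have dims [simp]: "dim_row X = r" "dim_col X = d" "dim_row M = r" "dim_col M = r"
    "dim_row K = r" "dim_col K = r" "dim_row J = r" "dim_col J = r" "dim_row W = d" "dim_col W = d"
    "dim_row Y = r" "dim_col Y = d" "dim_row (mat_inv J) = r" "dim_col (mat_inv J) = r"
    "dim_row (mat_inv W) = d" "dim_col (mat_inv W) = d"
    using X cM I cJ cW Y IJ IW by auto
  have "J * Y = (J * mat_inv J) * X" by (simp add: Y_def mat_algebra)
  then show JY: "J * Y = X" using IJ X by simp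
  have MK: "M * (K * X) = X"
    using I X by (simp add: mult_assoc_dim[symmetric])
  \<comment> \<open>Push-through identity: \<open>J\<close> applied to \<open>K * X\<close> gives
    \<open>X * W\<close>, so \<open>K * X = Y * W\<close>. Its adjoint, multiplied by
    \<open>X\<close>, shows that \<open>1\<^sub>m d - Y\<^sup>H * X\<close> inverts
    \<open>W\<close>.\<close>
  have "J * (K * X) = X * (X\<^sup>H * (K * X)) + X" by (simp add: J_def mat_algebra MK)
  also have "\<dots> = X + X * (X\<^sup>H * (K * X))" by (rule comm_add_mat[of _ r d]) (use X I in auto)
  also have "\<dots> = X * W" by (simp add: W_def K_def[symmetric] mat_algebra)
  finally have JKX: "J * (K * X) = X * W" .
  have "K * X = (mat_inv J * J) * (K * X)" using IJ I X by simp
  also have "\<dots> = mat_inv J * (X * W)" by (simp add: mat_algebra JKX)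
  also have "\<dots> = Y * W" by (simp add: Y_def mat_algebra)
  finally have "(K * X)\<^sup>H = (Y * W)\<^sup>H" by simp
  then have WY: "W * Y\<^sup>H = X\<^sup>H * K"
    by (simp add: mat_algebra gram_hermitian[OF gK] gram_hermitian[OF posdef_gram[OF W]])
  have "W * (1\<^sub>m d - Y\<^sup>H * X) = W - (W * Y\<^sup>H) * X" by (simp add: mat_algebra)
  also have "\<dots> = W - X\<^sup>H * (K * X)" unfolding WY by (simp add: mat_algebra)
  also have "\<dots> = 1\<^sub>m d"
    unfolding W_def K_def[symmetric] by (rule eq_matI) (auto simp del: index_mult_mat(1))
  finally have WE: "W * (1\<^sub>m d - Y\<^sup>H * X) = 1\<^sub>m d" .
  have cE: "1\<^sub>m d - Y\<^sup>H * X \<in> carrier_mat d d" by (simp add: carrier_matI)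
  have "mat_inv W = mat_inv W * (W * (1\<^sub>m d - Y\<^sup>H * X))" unfolding WE by (simp add: mat_algebra)
  also have "\<dots> = (mat_inv W * W) * (1\<^sub>m d - Y\<^sup>H * X)"
    by (rule mult_assoc_dim[symmetric]) simp_all
  also have "\<dots> = 1\<^sub>m d - Y\<^sup>H * X" using IW cE by simp
  finally show "mat_inv W = 1\<^sub>m d - Y\<^sup>H * X" .
qed

text \<open>Among all receivers \<open>Y\<close> the minimum mean square error receiver \<open>Z\<close> has the least error
  covariance; the excess is \<open>(Y - Z)\<^sup>H * J * (Y - Z)\<close>.\<close>

lemma weighted_mse_ge:
  assumes W: "gram d W" and J: "gram r J" and Y: "Y \<in> carrier_mat r d" and Z: "Z \<in> carrier_mat r d"
    and JZ: "J * Z = X"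
  shows "Re (mtrace (W * (1\<^sub>m d - Z\<^sup>H * X)))
    \<le> Re (mtrace W) - 2 * Re (mtrace (W * (Y\<^sup>H * X))) + Re (mtrace (W * (Y\<^sup>H * (J * Y))))"
proof -
  have dims [simp]: "dim_row W = d" "dim_col W = d" "dim_row J = r" "dim_col J = r"
    "dim_row Y = r" "dim_col Y = d" "dim_row Z = r" "dim_col Z = d"
    using gram_dim[OF W] gram_dim[OF J] Y Z by auto
  have dX [simp]: "dim_row X = r" "dim_col X = d" unfolding JZ[symmetric] by simp_all
  have ZJ: "Z\<^sup>H * (J * Y) = X\<^sup>H * Y"
  proof -
    have "Z\<^sup>H * (J * Y) = (J * Z)\<^sup>H * Y" by (simp add: mat_algebra gram_hermitian[OF J])
    then show ?thesis by (simp add: JZ)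
  qed
  have "mtrace (W * (X\<^sup>H * Y)) = cnj (mtrace ((W * (X\<^sup>H * Y))\<^sup>H))"
    by (subst mtrace_adjoint) simp_all
  also have "(W * (X\<^sup>H * Y))\<^sup>H = Y\<^sup>H * X * W" by (simp add: mat_algebra gram_hermitian[OF W])
  also have "mtrace (Y\<^sup>H * X * W) = mtrace (W * (Y\<^sup>H * X))" by (rule mtrace_mult_comm) simp_all
  finally have swap: "mtrace (W * (X\<^sup>H * Y)) = cnj (mtrace (W * (Y\<^sup>H * X)))" .
  \<comment> \<open>Expanding the trace of this excess against \<open>W\<close>, which is
    nonnegative, is the claimed inequality.\<close>
  have "gram d ((Y - Z)\<^sup>H * (J * (Y - Z)))"
    using gram_congruence[OF J, of "(Y - Z)\<^sup>H" d] Y Z by (simp add: minus_carrier_mat)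
  from gram_trace_nonneg[OF this W]
  show ?thesis
    by (simp add: mat_algebra mtrace_algebra JZ ZJ swap algebra_simps)
qed

text \<open>Stated in increments so that constants cancel: \<open>J * Y = X\<close> makes the
  quadratic term at the old point equal to the linear one, and \<open>W\<close> times its inverse
  accounts for \<open>d\<close>. All dependence on interference at the new point sits in
  \<open>J'\<close>.\<close>

lemma log_det_minorant:
  assumes X: "X \<in> carrier_mat r d" and X': "X' \<in> carrier_mat r d"
    and M: "posdef r M" and M': "posdef r M'"
  defines "J \<equiv> X * X\<^sup>H + M" and "J' \<equiv> X' * X'\<^sup>H + M'"
  defines "W \<equiv> 1\<^sub>m d + X\<^sup>H * (mat_inv M * X)"
  defines "W' \<equiv> 1\<^sub>m d + X'\<^sup>H * (mat_inv M' * X')"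
  defines "Y \<equiv> mat_inv J * X"
  shows "2 * (Re (mtrace (W * (Y\<^sup>H * X'))) - Re (mtrace (W * (Y\<^sup>H * X))))
      - (Re (mtrace (W * (Y\<^sup>H * (J' * Y)))) - Re (mtrace (W * (Y\<^sup>H * (J * Y)))))
    \<le> log_det W' - log_det W"
proof -
  note E = mmse_inverse[OF X M, folded J_def W_def, folded Y_def]
  define Z where "Z = mat_inv J' * X'"
  note E' = mmse_inverse[OF X' M', folded J'_def W'_def, folded Z_def]
  have "log_det W - log_det W' \<le> Re (mtrace (W * (1\<^sub>m d - Z\<^sup>H * X'))) - real d"
    using log_det_diff_le[OF E(2) E'(2)] by (simp add: E'(5))
  also have "\<dots> \<le> Re (mtrace W) - 2 * Re (mtrace (W * (Y\<^sup>H * X'))) + Re (mtrace (W * (Y\<^sup>H * (J' * Y)))) - real d"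
    using weighted_mse_ge[OF posdef_gram[OF E(2)] E'(1) E(3) E'(3,4)] by simp
  finally have *: "log_det W - log_det W'
    \<le> Re (mtrace W) - 2 * Re (mtrace (W * (Y\<^sup>H * X'))) + Re (mtrace (W * (Y\<^sup>H * (J' * Y)))) - real d" .
  have cW: "W \<in> carrier_mat d d" using E(2) posdef_gram gram_carrier by blast
  have "W * (1\<^sub>m d - Y\<^sup>H * X) = 1\<^sub>m d"
    using mat_inv(2)[OF cW posdef_det_nonzero[OF E(2)]] by (simp add: E(5))
  then have "real d = Re (mtrace (W * (1\<^sub>m d - Y\<^sup>H * X)))" by (simp add: mtrace_one)
  also have "\<dots> = Re (mtrace W) - Re (mtrace (W * (Y\<^sup>H * X)))"
    using cW E(3) X by (simp add: mat_algebra mtrace_algebra)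
  finally show ?thesis using * by (simp add: E(4))
qed


section \<open>The projected step\<close>

text \<open>The obtuse angle criterion. By the closed form both differences involve a multiple of
  \<open>X\<close>, and the inner product factors with the nonnegative factor
  \<open>1 - s\<close>.\<close>

lemma ball_proj_variational:
  assumes P: "0 < P" and X: "X \<in> carrier_mat n m" and V: "V \<in> carrier_mat n m"
    and fV: "(frob_norm V)\<^sup>2 \<le> P"
  shows "Re (mtrace ((X - ball_proj P X)\<^sup>H * (V - ball_proj P X))) \<le> 0"
proof -
  define s where "s = min 1 (sqrt P / frob_norm X)"
  have dims [simp]: "dim_row X = n" "dim_col X = m" "dim_row V = n" "dim_col V = m" using X V by auto
  have pr: "ball_proj P X = rscale s X" by (simp add: ball_proj_def s_def)
  have eq: "Re (mtrace ((X - ball_proj P X)\<^sup>H * (V - ball_proj P X)))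
      = (1 - s) * (Re (mtrace (X\<^sup>H * V)) - s * (frob_norm X)\<^sup>2)"
    by (simp add: pr mat_algebra mtrace_algebra Re_mtrace_adjoint_mult_self algebra_simps)
  have "frob_norm V \<le> sqrt P" using fV real_le_rsqrt by blast
  then have "Re (mtrace (X\<^sup>H * V)) \<le> frob_norm X * sqrt P"
    by (intro order.trans[OF frob_Cauchy_Schwarz] mult_left_mono frob_norm_nonneg) simp_all
  \<comment> \<open>For \<open>X = 0\<close> division by zero gives \<open>s = 0\<close>, and the
    second alternative reads \<open>0 = 0\<close>.\<close>
  moreover have "s = 1 \<or> (s \<le> 1 \<and> s * (frob_norm X)\<^sup>2 = frob_norm X * sqrt P)"
    by (cases "frob_norm X = 0") (auto simp: s_def min_def power2_eq_square)
  ultimately show ?thesis unfolding eq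
    by (cases "s = 1") (simp, intro mult_nonneg_nonpos, auto)
qed

text \<open>The claim concerns the increment of a concave quadratic with half-gradient
  \<open>G\<close> and curvature \<open>L\<close>. The obtuse angle at the old point gives
  \<open>lam * (frob_norm D)\<^sup>2 \<le> alpha * Re (mtrace (G\<^sup>H * D))\<close>. Hence the
  inner product is nonnegative, and \<open>alpha < 2\<close> lets the linear term absorb the
  curvature term.\<close>

lemma projected_step_ascent:
  assumes P: "0 < P" and V: "V \<in> carrier_mat n m" and fV: "(frob_norm V)\<^sup>2 \<le> P"
    and G: "G \<in> carrier_mat n m" and lam: "0 < lam" and alpha: "0 < alpha" "alpha < 2"
    and L: "L \<in> carrier_mat n n" "L\<^sup>H = L" "lambda_max L \<le> lam"
  defines "D \<equiv> ball_proj P (V + rscale (alpha / lam) G) - V"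
  shows "0 \<le> 2 * Re (mtrace (G\<^sup>H * D)) - Re (mtrace (D\<^sup>H * (L * D)))"
proof -
  let ?c = "alpha / lam"
  let ?X = "V + rscale ?c G"
  define V' where "V' = ball_proj P ?X"
  have X: "?X \<in> carrier_mat n m" using V G by (simp add: rscale_def)
  have V': "V' \<in> carrier_mat n m" unfolding V'_def by (rule ball_proj_nearest(1)[OF P X])
  have DV: "D = V' - V" by (simp add: D_def V'_def)
  have D: "D \<in> carrier_mat n m" using V V' by (simp add: DV minus_carrier_mat)
  have dims [simp]: "dim_row V = n" "dim_col V = m" "dim_row V' = n" "dim_col V' = m"
    "dim_row G = n" "dim_col G = m" "dim_row D = n" "dim_col D = m" using V V' G D by auto
  have "?X - V' = rscale ?c G - D" "V - V' = rscale (-1) D"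
    by (rule eq_matI; simp add: DV rscale_def)+
  then have "Re (mtrace ((rscale ?c G - D)\<^sup>H * rscale (-1) D)) \<le> 0"
    using ball_proj_variational[OF P X V fV] by (simp add: V'_def[symmetric])
  then have "(frob_norm D)\<^sup>2 \<le> ?c * Re (mtrace (G\<^sup>H * D))"
    by (simp add: mat_algebra mtrace_algebra Re_mtrace_adjoint_mult_self)
  then have "lam * (frob_norm D)\<^sup>2 \<le> alpha * Re (mtrace (G\<^sup>H * D))"
    using lam by (simp add: field_simps)
  moreover have "0 \<le> Re (mtrace (G\<^sup>H * D))"
  proof -
    have "0 \<le> alpha * Re (mtrace (G\<^sup>H * D))"
      using calculation lam by (smt (verit) mult_nonneg_nonneg zero_le_power2)
    then show ?thesis using alpha by (simp add: zero_le_mult_iff)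
  qed
  then have "alpha * Re (mtrace (G\<^sup>H * D)) \<le> 2 * Re (mtrace (G\<^sup>H * D))"
    using alpha by (intro mult_right_mono) auto
  ultimately show ?thesis
    using quadratic_le_lambda_max[OF L D] by linarith
qed

section \<open>Summation over the network\<close>

lemma mtrace_mult_mat_sum:
  assumes F: "\<And>s. s \<in> S \<Longrightarrow> F s \<in> carrier_mat n n"
    and A: "A \<in> carrier_mat m n" and B: "B \<in> carrier_mat n m"
  shows "mtrace (A * (mat_sum n n F S * B)) = (\<Sum>s\<in>S. mtrace (A * (F s * B)))"
proof -
  have "mat_sum n n F S * B = mat_sum n m (\<lambda>s. F s * B) S"
    using mat_sum_mult[OF F, where A = B] B by auto
  moreover have "A * mat_sum n m (\<lambda>s. F s * B) S = mat_sum m m (\<lambda>s. A * (F s * B)) S"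
    using mult_mat_sum[of S "\<lambda>s. F s * B" n m A] mult_carrier_mat[OF F B] A by auto
  ultimately have "A * (mat_sum n n F S * B) = mat_sum m m (\<lambda>s. A * (F s * B)) S" by simp
  moreover have "mtrace (mat_sum m m (\<lambda>s. A * (F s * B)) S) = (\<Sum>s\<in>S. mtrace (A * (F s * B)))"
    by (rule mtrace_mat_sum) (use F A B in auto)
  ultimately show ?thesis by simp
qed

lemma finite_active_slots: "finite (active_slots net k)"
  by (rule finite_subset[of _ "{..<num_users net} \<times> {..<num_slots net}"]) (auto simp: active_slots_def)

lemma finite_cochannel: "finite (cochannel net k u i)"
  by (rule finite_subset[OF _ finite_active_slots[of net k]]) (auto simp: cochannel_def)

text \<open>Being on the same resource block group is a symmetric relation between active
  slots.\<close>

lemma sum_cochannel_swap: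
  "(\<Sum>(u, i)\<in>active_slots net k. \<Sum>(j, l)\<in>cochannel net k u i. g u i j l)
    = (\<Sum>(j, l)\<in>active_slots net k. \<Sum>(u, i)\<in>cochannel net k j l. g u i j l)"
  for g :: "nat \<Rightarrow> nat \<Rightarrow> nat \<Rightarrow> nat \<Rightarrow> real"
proof -
  let ?S = "active_slots net k"
  let ?g = "\<lambda>p q. g (fst p) (snd p) (fst q) (snd q)"
  let ?R = "\<lambda>p q. k (fst q) (snd q) = k (fst p) (snd p)"
  have 1: "cochannel net k (fst p) (snd p) = {q \<in> ?S. ?R p q}" for p
    by (auto simp: cochannel_def)
  have 2: "cochannel net k (fst q) (snd q) = {p \<in> ?S. ?R p q}" for q
    by (auto simp: cochannel_def)
  have "(\<Sum>p\<in>?S. \<Sum>q\<in>{q \<in> ?S. ?R p q}. ?g p q) = (\<Sum>q\<in>?S. \<Sum>p\<in>{p \<in> ?S. ?R p q}. ?g p q)"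
    by (rule sum.swap_restrict) (rule finite_active_slots)+
  then show ?thesis
    unfolding 1[symmetric] 2[symmetric] case_prod_unfold .
qed

text \<open>The dimension half of \<open>feasible\<close>: what the surrogate inequality asks of
  both points. The power budget enters with the projection.\<close>

definition shaped :: "network \<Rightarrow> alloc \<Rightarrow> beams \<Rightarrow> bool" where
  "shaped net k V \<longleftrightarrow>
    (\<forall>(u, i)\<in>active_slots net k. V u i \<in> carrier_mat (tx_ants net) (streams net u))"

context
  fixes net :: network and k :: alloc
  assumes net: "valid_network net" and alloc: "valid_alloc net k"
begin

text \<open>Here \<open>b\<close> is a user, whose serving base station transmits; this is how all
  channels occur below.\<close>

lemma chan_from_carrier:
  assumes "(u, i) \<in> active_slots net k" "b < num_users net" "j < num_users net"
  shows "chan_from net k (serving_bs net b) u i j \<in> carrier_mat (rx_ants net) (tx_ants net)"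
  using assms net alloc
  by (auto simp: chan_from_def active_slots_def valid_network_def valid_alloc_def)

lemma user_bound: "(u, i) \<in> active_slots net k \<Longrightarrow> u < num_users net"
  by (simp add: active_slots_def)

lemma cochannel_active: "(j, l) \<in> cochannel net k u i \<Longrightarrow> (j, l) \<in> active_slots net k"
  by (simp add: cochannel_def)

text \<open>Lets a channel be indexed by the slot at either end, as the exchange of transmitter and
  receiver requires.\<close>

lemma chan_from_cochannel:
  "(j, l) \<in> cochannel net k u i \<Longrightarrow> chan_from net k b j l v = chan_from net k b u i v"
  by (simp add: cochannel_def chan_from_def)

lemma weight_nonneg: "(u, i) \<in> active_slots net k \<Longrightarrow> 0 \<le> weight net u"
  using net user_bound by (auto simp: valid_network_def)

lemma own_chan_carrier:
  "(u, i) \<in> active_slots net k \<Longrightarrow> own_chan net k u i \<in> carrier_mat (rx_ants net) (tx_ants net)"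
  unfolding own_chan_def by (intro chan_from_carrier user_bound)

lemma shapedD: "shaped net k V \<Longrightarrow> (u, i) \<in> active_slots net k \<Longrightarrow>
    V u i \<in> carrier_mat (tx_ants net) (streams net u)"
  by (auto simp: shaped_def)

lemma gram_received:
  assumes V: "shaped net k V" and s: "(u, i) \<in> active_slots net k" and t: "(j, l) \<in> cochannel net k u i"
  shows "gram (rx_ants net) (chan_from net k (serving_bs net j) u i u * V j l * (V j l)\<^sup>H
    * (chan_from net k (serving_bs net j) u i u)\<^sup>H)"
proof -
  let ?H = "chan_from net k (serving_bs net j) u i u"
  have H: "?H \<in> carrier_mat (rx_ants net) (tx_ants net)"
    using chan_from_carrier s user_bound cochannel_active[OF t] by blast
  have v: "V j l \<in> carrier_mat (tx_ants net) (streams net j)"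
    using shapedD[OF V cochannel_active[OF t]] .
  have "gram (rx_ants net) ((?H * V j l) * (?H * V j l)\<^sup>H)"
    by (rule gram_mult_adjoint) (use H v in auto)
  then show ?thesis using H v by (simp add: mat_algebra)
qed

lemma posdef_M_mat:
  assumes V: "shaped net k V" and s: "(u, i) \<in> active_slots net k"
  shows "posdef (rx_ants net) (M_mat net k V u i)"
  unfolding M_mat_def
proof (intro posdefI gram_mat_sum)
  show "0 < noise_power net" using net by (simp add: valid_network_def)
qed (use gram_received[OF V s] finite_cochannel in auto)

text \<open>The own signal fills the gap left in the interference sum.\<close>

lemma J_mat_eq:
  assumes V: "shaped net k V" and s: "(u, i) \<in> active_slots net k"
  shows "J_mat net k V u i =
    mat_sum (rx_ants net) (rx_ants net)
      (\<lambda>(j, l). chan_from net k (serving_bs net j) u i u * V j l * (V j l)\<^sup>H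
         * (chan_from net k (serving_bs net j) u i u)\<^sup>H)
      (cochannel net k u i)
    + rscale (noise_power net) (1\<^sub>m (rx_ants net))"
proof -
  let ?F = "\<lambda>(j, l). chan_from net k (serving_bs net j) u i u * V j l * (V j l)\<^sup>H
         * (chan_from net k (serving_bs net j) u i u)\<^sup>H"
  have self: "(u, i) \<in> cochannel net k u i" using s by (simp add: cochannel_def)
  then have "cochannel net k u i = insert (u, i) (cochannel net k u i - {(u, i)})" by blast
  moreover have "mat_sum (rx_ants net) (rx_ants net) ?F (insert (u, i) (cochannel net k u i - {(u, i)}))
      = mat_sum (rx_ants net) (rx_ants net) ?F (cochannel net k u i - {(u, i)}) + ?F (u, i)"
    using gram_carrier[OF gram_received[OF V s self]]
    by (intro mat_sum_insert) (auto intro: finite_cochannel)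
  ultimately have "mat_sum (rx_ants net) (rx_ants net) ?F (cochannel net k u i)
      = mat_sum (rx_ants net) (rx_ants net) ?F (cochannel net k u i - {(u, i)}) + ?F (u, i)"
    by simp
  moreover have "?F (u, i) \<in> carrier_mat (rx_ants net) (rx_ants net)"
    using gram_carrier[OF gram_received[OF V s self]] by simp
  ultimately show ?thesis
    unfolding J_mat_def M_mat_def own_chan_def
    by (intro eq_matI) (auto simp del: index_mult_mat(1))
qed

text \<open>Rebrackets the network quantities around the effective channel \<open>X\<close>, the
  form in which the surrogate lemmas apply.\<close>

lemma slot_matrices:
  assumes V: "shaped net k V" and s: "(u, i) \<in> active_slots net k"
  defines "X \<equiv> own_chan net k u i * V u i"
  shows "X \<in> carrier_mat (rx_ants net) (streams net u)"
    "Gamma_mat net k V u i = X\<^sup>H * (mat_inv (M_mat net k V u i) * X)"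
    "J_mat net k V u i = X * X\<^sup>H + M_mat net k V u i"
    "gram (rx_ants net) (J_mat net k V u i)"
    "posdef (streams net u) (1\<^sub>m (streams net u) + Gamma_mat net k V u i)"
    "Y_mat net k V u i = mat_inv (J_mat net k V u i) * X"
    "Y_mat net k V u i \<in> carrier_mat (rx_ants net) (streams net u)"
proof -
  note H = own_chan_carrier[OF s] and v = shapedD[OF V s]
  show X: "X \<in> carrier_mat (rx_ants net) (streams net u)" using H v by (simp add: X_def)
  note M = posdef_M_mat[OF V s]
  have cM: "M_mat net k V u i \<in> carrier_mat (rx_ants net) (rx_ants net)"
    using M posdef_gram gram_carrier by blast
  note I = mat_inv(1)[OF cM posdef_det_nonzero[OF M]]
  show G: "Gamma_mat net k V u i = X\<^sup>H * (mat_inv (M_mat net k V u i) * X)"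
    using H v I by (simp add: Gamma_mat_def X_def mat_algebra)
  show J: "J_mat net k V u i = X * X\<^sup>H + M_mat net k V u i"
    using H v by (simp add: J_mat_def X_def mat_algebra)
  note E = mmse_inverse[OF X M, folded J G]
  show gJ: "gram (rx_ants net) (J_mat net k V u i)" by (rule E(1))
  show "posdef (streams net u) (1\<^sub>m (streams net u) + Gamma_mat net k V u i)" by (rule E(2))
  have "J_mat net k V u i \<in> carrier_mat (rx_ants net) (rx_ants net)" using gJ gram_carrier by blast
  \<comment> \<open>Rebracketing \<open>Y_mat\<close> needs the width of the inverse, which is known
    once the determinant is nonzero, hence from definiteness of J.\<close>
  have dI: "dim_col (mat_inv (J_mat net k V u i)) = rx_ants net"
  proof -
    have "M_mat net k V u i + X * X\<^sup>H = X * X\<^sup>H + M_mat net k V u i"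
      by (rule comm_add_mat[OF cM]) (use X in simp)
    then have "posdef (rx_ants net) (J_mat net k V u i)"
      unfolding J using posdef_add_gram[OF M gram_mult_adjoint[OF X]] by simp
    then show ?thesis
      using mat_inv(1)[OF gram_carrier[OF gJ] posdef_det_nonzero] by auto
  qed
  show Y: "Y_mat net k V u i = mat_inv (J_mat net k V u i) * X"
    using H v dI by (simp add: Y_mat_def X_def mat_algebra)
  show "Y_mat net k V u i \<in> carrier_mat (rx_ants net) (streams net u)"
    unfolding Y by (rule E(3))
qed

lemma gram_Psi_mat:
  assumes V: "shaped net k V" and s: "(u, i) \<in> active_slots net k"
  shows "gram (rx_ants net) (Psi_mat net k V u i)"
proof -
  note S = slot_matrices[OF V s]
  have "gram (rx_ants net) (Y_mat net k V u i * ((1\<^sub>m (streams net u) + Gamma_mat net k V u i) * (Y_mat net k V u i)\<^sup>H))"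
    by (rule gram_congruence[OF posdef_gram[OF S(5)] S(7)])
  then show ?thesis
    using S(7) gram_dim[OF posdef_gram[OF S(5)]]
    by (simp add: Psi_mat_def mult_assoc_dim)
qed

lemma gram_L_summand:
  assumes V: "shaped net k V" and s: "(u, i) \<in> active_slots net k" and t: "(j, l) \<in> cochannel net k u i"
  shows "gram (tx_ants net) (rscale (weight net j)
         ((chan_from net k (serving_bs net u) u i j)\<^sup>H * Psi_mat net k V j l
           * chan_from net k (serving_bs net u) u i j))"
proof -
  let ?H = "chan_from net k (serving_bs net u) u i j"
  note t' = cochannel_active[OF t]
  have H: "?H \<in> carrier_mat (rx_ants net) (tx_ants net)"
    using chan_from_carrier s user_bound t' by blast
  note P = gram_Psi_mat[OF V t']
  have "gram (tx_ants net) (?H\<^sup>H * (Psi_mat net k V j l * ?H))"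
    using gram_congruence[OF P, of "?H\<^sup>H" "tx_ants net"] H by simp
  then show ?thesis
    using H gram_dim[OF P] weight_nonneg[OF t'] by (intro gram_rscale) (simp_all add: mat_algebra)
qed

lemma gram_L_mat:
  assumes V: "shaped net k V" and s: "(u, i) \<in> active_slots net k"
  shows "gram (tx_ants net) (L_mat net k V u i)"
  unfolding L_mat_def
  by (rule gram_mat_sum[OF finite_cochannel]) (use gram_L_summand[OF V s] in auto)

lemma Lambda_mat_carrier:
  assumes V: "shaped net k V" and s: "(u, i) \<in> active_slots net k"
  shows "Lambda_mat net k V u i \<in> carrier_mat (tx_ants net) (streams net u)"
  using slot_matrices[OF V s] own_chan_carrier[OF s] gram_dim
  by (intro carrier_matI) (auto simp: Lambda_mat_def posdef_def)

text \<open>The quadratic part of the surrogate of slot \<open>(u, i)\<close> splits into the contributions of the beams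
  \<open>(j, l)\<close> on its resource block group. Summed over the slots \<open>(u, i)\<close> for a fixed beam \<open>(j, l)\<close>, they
  make up the quadratic form of \<^const>\<open>L_mat\<close> at \<open>(j, l)\<close>.\<close>

definition leakage :: "beams \<Rightarrow> beams \<Rightarrow> nat \<Rightarrow> nat \<Rightarrow> nat \<Rightarrow> nat \<Rightarrow> real" where
  "leakage V V' u i j l = weight net u * Re (mtrace ((V' j l)\<^sup>H *
    ((chan_from net k (serving_bs net j) u i u)\<^sup>H * Psi_mat net k V u i
      * chan_from net k (serving_bs net j) u i u * V' j l)))"

text \<open>Here \<open>(u, i)\<close> is the transmitting beam and \<open>(j, l)\<close> ranges
  over the slots it reaches, hence the swapped arguments of \<open>leakage\<close>.\<close>

lemma L_mat_quadratic:
  assumes V: "shaped net k V" and V': "shaped net k V'" and s: "(u, i) \<in> active_slots net k"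
  shows "Re (mtrace ((V' u i)\<^sup>H * (L_mat net k V u i * V' u i)))
    = (\<Sum>(j, l)\<in>cochannel net k u i. leakage V V' j l u i)"
proof -
  let ?F = "\<lambda>(j, l). rscale (weight net j)
         ((chan_from net k (serving_bs net u) u i j)\<^sup>H * Psi_mat net k V j l
           * chan_from net k (serving_bs net u) u i j)"
  note v = shapedD[OF V' s]
  have F: "?F p \<in> carrier_mat (tx_ants net) (tx_ants net)" if "p \<in> cochannel net k u i" for p
    using gram_carrier[OF gram_L_summand[OF V s]] that by (cases p) auto
  have eq: "mtrace ((V' u i)\<^sup>H * (L_mat net k V u i * V' u i))
      = (\<Sum>p\<in>cochannel net k u i. mtrace ((V' u i)\<^sup>H * (?F p * V' u i)))"
    unfolding L_mat_def by (rule mtrace_mult_mat_sum) (use F v in auto)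
  show ?thesis
    unfolding eq Re_sum
  proof (rule sum.cong[OF refl])
    fix p assume "p \<in> cochannel net k u i"
    then obtain j l where p: "p = (j, l)" and t: "(j, l) \<in> cochannel net k u i" by (cases p) auto
    have H: "chan_from net k (serving_bs net u) u i j \<in> carrier_mat (rx_ants net) (tx_ants net)"
      using chan_from_carrier s user_bound cochannel_active[OF t] by blast
    show "Re (mtrace ((V' u i)\<^sup>H * (?F p * V' u i))) = (case p of (j, l) \<Rightarrow> leakage V V' j l u i)"
      unfolding p prod.case leakage_def chan_from_cochannel[OF t]
      using H v by (simp add: rscale_mult mult_rscale mtrace_rscale)
  qed
qed

text \<open>Here \<open>(u, i)\<close> receives; cyclicity of the trace turns each received power
  into a form in the transmitted beam. The noise term does not depend on \<open>V'\<close> and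
  cancels in increments.\<close>

lemma J_mat_quadratic:
  assumes V: "shaped net k V" and V': "shaped net k V'" and s: "(u, i) \<in> active_slots net k"
  defines "W \<equiv> 1\<^sub>m (streams net u) + Gamma_mat net k V u i" and "Y \<equiv> Y_mat net k V u i"
  shows "weight net u * Re (mtrace (W * (Y\<^sup>H * (J_mat net k V' u i * Y))))
    = (\<Sum>(j, l)\<in>cochannel net k u i. leakage V V' u i j l)
      + weight net u * noise_power net * Re (mtrace (W * (Y\<^sup>H * Y)))"
proof -
  let ?F = "\<lambda>(j, l). chan_from net k (serving_bs net j) u i u * V' j l * (V' j l)\<^sup>H
         * (chan_from net k (serving_bs net j) u i u)\<^sup>H"
  let ?r = "rx_ants net"
  note S = slot_matrices[OF V s, folded W_def Y_def]
  have dims [simp]: "dim_row W = streams net u" "dim_col W = streams net u"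
    "dim_row Y = ?r" "dim_col Y = streams net u"
    using gram_dim[OF posdef_gram[OF S(5)]] S(7) by auto
  have F: "?F p \<in> carrier_mat ?r ?r" if "p \<in> cochannel net k u i" for p
    using gram_carrier[OF gram_received[OF V' s]] that by (cases p) auto
  have "mtrace (W * (Y\<^sup>H * (J_mat net k V' u i * Y)))
      = mtrace ((W * Y\<^sup>H) * (mat_sum ?r ?r ?F (cochannel net k u i) * Y))
        + noise_power net * mtrace (W * (Y\<^sup>H * Y))"
    unfolding J_mat_eq[OF V' s] by (simp add: mat_algebra mtrace_algebra)
  also have "mtrace ((W * Y\<^sup>H) * (mat_sum ?r ?r ?F (cochannel net k u i) * Y))
      = (\<Sum>p\<in>cochannel net k u i. mtrace ((W * Y\<^sup>H) * (?F p * Y)))"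
    by (rule mtrace_mult_mat_sum) (use F in \<open>auto intro: carrier_matI\<close>)
  finally have "weight net u * Re (mtrace (W * (Y\<^sup>H * (J_mat net k V' u i * Y))))
      = (\<Sum>p\<in>cochannel net k u i. weight net u * Re (mtrace ((W * Y\<^sup>H) * (?F p * Y))))
      + weight net u * noise_power net * Re (mtrace (W * (Y\<^sup>H * Y)))"
    by (simp add: distrib_left sum_distrib_left)
  also have "(\<Sum>p\<in>cochannel net k u i. weight net u * Re (mtrace ((W * Y\<^sup>H) * (?F p * Y))))
      = (\<Sum>(j, l)\<in>cochannel net k u i. leakage V V' u i j l)"
  proof (rule sum.cong[OF refl])
    fix p assume "p \<in> cochannel net k u i"
    then obtain j l where p: "p = (j, l)" and t: "(j, l) \<in> cochannel net k u i" by (cases p) auto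
    let ?H = "chan_from net k (serving_bs net j) u i u"
    have H: "?H \<in> carrier_mat ?r (tx_ants net)"
      using chan_from_carrier s user_bound cochannel_active[OF t] by blast
    note v = shapedD[OF V' cochannel_active[OF t]]
    have dv [simp]: "dim_row ?H = ?r" "dim_col ?H = tx_ants net"
      "dim_row (V' j l) = tx_ants net" "dim_col (V' j l) = streams net j" using H v by auto
    have "mtrace ((W * (Y\<^sup>H * (?H * V' j l))) * ((V' j l)\<^sup>H * (?H\<^sup>H * Y)))
        = mtrace (((V' j l)\<^sup>H * (?H\<^sup>H * Y)) * (W * (Y\<^sup>H * (?H * V' j l))))"
      by (rule mtrace_mult_comm) simp_all
    then show "weight net u * Re (mtrace ((W * Y\<^sup>H) * (?F p * Y))) = (case p of (j, l) \<Rightarrow> leakage V V' u i j l)"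
      by (simp add: p leakage_def Psi_mat_def W_def[symmetric] Y_def[symmetric] mult_assoc_dim)
  qed
  finally show ?thesis .
qed

lemma Lambda_mat_trace:
  assumes V: "shaped net k V" and V': "shaped net k V'" and s: "(u, i) \<in> active_slots net k"
  shows "weight net u * Re (mtrace ((1\<^sub>m (streams net u) + Gamma_mat net k V u i)
      * ((Y_mat net k V u i)\<^sup>H * (own_chan net k u i * V' u i))))
    = Re (mtrace ((Lambda_mat net k V u i)\<^sup>H * V' u i))"
proof -
  define W where "W = 1\<^sub>m (streams net u) + Gamma_mat net k V u i"
  note S = slot_matrices[OF V s, folded W_def]
  note H = own_chan_carrier[OF s] and v = shapedD[OF V' s]
  have hW: "W\<^sup>H = W" by (rule gram_hermitian[OF posdef_gram[OF S(5)]])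
  show ?thesis
    unfolding W_def[symmetric] Lambda_mat_def
    using S(7) H v gram_dim[OF posdef_gram[OF S(5)]]
    by (simp add: mult_assoc_dim adjoint_mult adjoint_rscale rscale_mult mtrace_rscale hW)
qed

lemma slot_gain:
  assumes V: "shaped net k V" and V': "shaped net k V'" and s: "(u, i) \<in> active_slots net k"
  shows "2 * (Re (mtrace ((Lambda_mat net k V u i)\<^sup>H * V' u i)) - Re (mtrace ((Lambda_mat net k V u i)\<^sup>H * V u i)))
      - ((\<Sum>(j, l)\<in>cochannel net k u i. leakage V V' u i j l) - (\<Sum>(j, l)\<in>cochannel net k u i. leakage V V u i j l))
    \<le> weight net u * log_det (1\<^sub>m (streams net u) + Gamma_mat net k V' u i)
      - weight net u * log_det (1\<^sub>m (streams net u) + Gamma_mat net k V u i)"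
proof -
  note S = slot_matrices[OF V s] and S' = slot_matrices[OF V' s]
  note * = log_det_minorant[OF S(1) S'(1) posdef_M_mat[OF V s] posdef_M_mat[OF V' s],
      folded S(2,3) S'(2,3), folded S(6)]
  from mult_left_mono[OF * weight_nonneg[OF s]]
  show ?thesis
    using J_mat_quadratic[OF V V s] J_mat_quadratic[OF V V' s]
      Lambda_mat_trace[OF V V s] Lambda_mat_trace[OF V V' s]
    by (simp add: algebra_simps)
qed

section \<open>Ascent of the weighted sum rate under the update\<close>

lemma feasible_shaped: "feasible net k V \<Longrightarrow> shaped net k V"
  by (auto simp: feasible_def shaped_def)

lemma bounded_update_eq:
  assumes V: "shaped net k V" and s: "(u, i) \<in> active_slots net k"
  defines "G \<equiv> Lambda_mat net k V u i - L_mat net k V u i * V u i"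
  shows "bounded_update net k V lam alpha u i
      = ball_proj (power_budget net) (V u i + rscale (alpha / lam) G)"
    "G \<in> carrier_mat (tx_ants net) (streams net u)"
proof -
  note v = shapedD[OF V s] and L = gram_dim[OF gram_L_mat[OF V s]]
  show G: "G \<in> carrier_mat (tx_ants net) (streams net u)"
    using L v by (intro carrier_matI) (auto simp: G_def)
  have "fp_point net k V lam u i - V u i = rscale (1 / lam) G"
    unfolding fp_point_def G_def[symmetric] using G v by (intro eq_matI) auto
  moreover have "rscale alpha (rscale (1 / lam) G) = rscale (alpha / lam) G"
    by (intro eq_matI) (auto simp: rscale_def)
  ultimately show "bounded_update net k V lam alpha u i
      = ball_proj (power_budget net) (V u i + rscale (alpha / lam) G)"
    by (simp add: bounded_update_def)
qed

lemma feasible_bounded_update: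
  assumes V: "feasible net k V"
    and V': "\<And>u i. (u, i) \<in> active_slots net k \<Longrightarrow>
      V' u i = bounded_update net k V (lam u i) (alpha u i) u i"
  shows "feasible net k V'"
  unfolding feasible_def
proof (clarify, intro conjI)
  fix u i assume s: "(u, i) \<in> active_slots net k"
  note U = bounded_update_eq[OF feasible_shaped[OF V] s]
  have P: "0 < power_budget net" using net by (simp add: valid_network_def)
  have X: "V u i + rscale (alpha u i / lam u i) (Lambda_mat net k V u i - L_mat net k V u i * V u i)
      \<in> carrier_mat (tx_ants net) (streams net u)"
    using U(2) by (intro carrier_matI) (auto dest: carrier_matD)
  show "V' u i \<in> carrier_mat (tx_ants net) (streams net u)"
    "(frob_norm (V' u i))\<^sup>2 \<le> power_budget net"
    unfolding V'[OF s] U(1) by (rule ball_proj_nearest(1,2)[OF P X])+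
qed

text \<open>For Hermitian \<open>L\<close> the increment of
  \<open>2 Re tr(Lambda^H B) - Re tr(B^H L B)\<close> from \<open>V\<close> equals its expansion at
  \<open>V\<close>, with half-gradient \<open>Lambda - L V\<close>.\<close>

lemma slot_ascent:
  assumes V: "feasible net k V" and s: "(u, i) \<in> active_slots net k"
    and lam: "0 < lam" "lambda_max (L_mat net k V u i) \<le> lam"
    and alpha: "0 < alpha" "alpha < 2"
    and v': "v' = bounded_update net k V lam alpha u i"
  shows "0 \<le> 2 * (Re (mtrace ((Lambda_mat net k V u i)\<^sup>H * v')) - Re (mtrace ((Lambda_mat net k V u i)\<^sup>H * V u i)))
    - (Re (mtrace (v'\<^sup>H * (L_mat net k V u i * v'))) - Re (mtrace ((V u i)\<^sup>H * (L_mat net k V u i * V u i))))"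
proof -
  define A L v where "A = Lambda_mat net k V u i" and "L = L_mat net k V u i" and "v = V u i"
  note V1 = feasible_shaped[OF V]
  note U = bounded_update_eq[OF V1 s, folded A_def L_def v_def]
  have P: "0 < power_budget net" using net by (simp add: valid_network_def)
  have gL: "gram (tx_ants net) L" unfolding L_def by (rule gram_L_mat[OF V1 s])
  have hL: "L\<^sup>H = L" by (rule gram_hermitian[OF gL])
  have cv: "v \<in> carrier_mat (tx_ants net) (streams net u)" unfolding v_def by (rule shapedD[OF V1 s])
  have fv: "(frob_norm v)\<^sup>2 \<le> power_budget net" using V s by (auto simp: feasible_def v_def)
  have cA: "A \<in> carrier_mat (tx_ants net) (streams net u)"
    unfolding A_def by (rule Lambda_mat_carrier[OF V1 s])
  have cv': "v' \<in> carrier_mat (tx_ants net) (streams net u)"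
    unfolding v' U(1) by (rule ball_proj_nearest(1)[OF P]) (use cv U(2) in \<open>simp add: rscale_def\<close>)
  have dims [simp]: "dim_row L = tx_ants net" "dim_col L = tx_ants net"
    "dim_row v = tx_ants net" "dim_col v = streams net u"
    "dim_row v' = tx_ants net" "dim_col v' = streams net u"
    "dim_row A = tx_ants net" "dim_col A = streams net u"
    using gram_dim[OF gL] cv cA cv' by auto
  have swap: "Re (mtrace (v'\<^sup>H * (L * v))) = Re (mtrace (v\<^sup>H * (L * v')))"
    using re_mtrace_swap[of "L * v" v'] by (simp add: adjoint_mult mult_assoc_dim hL)
  have "0 \<le> 2 * Re (mtrace ((A - L * v)\<^sup>H * (v' - v))) - Re (mtrace ((v' - v)\<^sup>H * (L * (v' - v))))"
    using projected_step_ascent[OF P cv fv U(2) lam(1) alpha gram_carrier[OF gL] hL lam(2)[folded L_def]]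
    unfolding v' U(1) .
  also have "\<dots> = 2 * (Re (mtrace (A\<^sup>H * v')) - Re (mtrace (A\<^sup>H * v)))
      - (Re (mtrace (v'\<^sup>H * (L * v'))) - Re (mtrace (v\<^sup>H * (L * v))))"
    by (simp add: mat_algebra mtrace_algebra hL swap)
  finally show ?thesis by (simp add: A_def L_def v_def)
qed

text \<open>\<open>slot_gain\<close> groups leakage by receiver and \<open>slot_ascent\<close> by
  transmitter; the two agree only after summation over all active slots.\<close>

lemma wsr_bounded_update:
  assumes V: "feasible net k V"
    and step: "\<And>u i. (u, i) \<in> active_slots net k \<Longrightarrow>
      0 < lam u i \<and> lambda_max (L_mat net k V u i) \<le> lam u i \<and> 0 < alpha u i \<and> alpha u i < 2 \<and>
      V' u i = bounded_update net k V (lam u i) (alpha u i) u i"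
  shows "wsr net k V \<le> wsr net k V'"
proof -
  let ?S = "active_slots net k"
  note V1 = feasible_shaped[OF V]
  have V2: "shaped net k V'"
    using feasible_shaped[OF feasible_bounded_update[OF V, of V' lam alpha]] step by simp
  let ?a = "\<lambda>u i. 2 * (Re (mtrace ((Lambda_mat net k V u i)\<^sup>H * V' u i)) - Re (mtrace ((Lambda_mat net k V u i)\<^sup>H * V u i)))"
  let ?q = "\<lambda>V' u i. Re (mtrace ((V' u i)\<^sup>H * (L_mat net k V u i * V' u i)))"
  have swap: "(\<Sum>(u, i)\<in>?S. \<Sum>(j, l)\<in>cochannel net k u i. leakage V B u i j l) = (\<Sum>(u, i)\<in>?S. ?q B u i)"
    if "shaped net k B" for B
    by (subst sum_cochannel_swap, rule sum.cong) (auto simp: L_mat_quadratic[OF V1 that])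
  have "0 \<le> (\<Sum>(u, i)\<in>?S. ?a u i - (?q V' u i - ?q V u i))"
    by (rule sum_nonneg, clarify, rule slot_ascent[OF V]) (use step in auto)
  also have "\<dots> = (\<Sum>(u, i)\<in>?S. ?a u i) - ((\<Sum>(u, i)\<in>?S. ?q V' u i) - (\<Sum>(u, i)\<in>?S. ?q V u i))"
    by (simp add: case_prod_unfold sum_subtractf)
  also have "\<dots> = (\<Sum>(u, i)\<in>?S. ?a u i - ((\<Sum>(j, l)\<in>cochannel net k u i. leakage V V' u i j l)
      - (\<Sum>(j, l)\<in>cochannel net k u i. leakage V V u i j l)))"
    unfolding swap[OF V1, symmetric] swap[OF V2, symmetric] by (simp add: case_prod_unfold sum_subtractf)
  also have "\<dots> \<le> (\<Sum>(u, i)\<in>?S. weight net u * log_det (1\<^sub>m (streams net u) + Gamma_mat net k V' u i)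
      - weight net u * log_det (1\<^sub>m (streams net u) + Gamma_mat net k V u i))"
    by (rule sum_mono, clarify, rule slot_gain[OF V1 V2])
  also have "\<dots> = wsr net k V' - wsr net k V"
    by (simp add: wsr_def case_prod_unfold sum_subtractf)
  finally show ?thesis by simp
qed

end

theorem lemma1:
  fixes net :: network and k :: alloc
  assumes "valid_network net" and "valid_alloc net k"
  shows
    "(\<forall>(V :: beams) (V' :: beams) (lam :: nat \<Rightarrow> nat \<Rightarrow> real) (alpha :: nat \<Rightarrow> nat \<Rightarrow> real).
        feasible net k V \<longrightarrow>
        (\<forall>(u, i)\<in>active_slots net k.
           0 < lam u i \<and> lambda_max (L_mat net k V u i) \<le> lam u i \<and>
           0 < alpha u i \<and> alpha u i < 2 \<and>
           V' u i = bounded_update net k V (lam u i) (alpha u i) u i) \<longrightarrow>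
        wsr net k V' \<ge> wsr net k V)
     \<and>
     (\<forall>(V :: nat \<Rightarrow> beams) (lam :: nat \<Rightarrow> nat \<Rightarrow> nat \<Rightarrow> real) (alpha :: nat \<Rightarrow> nat \<Rightarrow> nat \<Rightarrow> real).
        feasible net k (V 0) \<longrightarrow>
        (\<forall>\<tau>\<ge>1. \<forall>(u, i)\<in>active_slots net k.
           0 < lam \<tau> u i \<and> lambda_max (L_mat net k (V (\<tau> - 1)) u i) \<le> lam \<tau> u i \<and>
           0 < alpha \<tau> u i \<and> alpha \<tau> u i < 2 \<and>
           V \<tau> u i = bounded_update net k (V (\<tau> - 1)) (lam \<tau> u i) (alpha \<tau> u i) u i) \<longrightarrow>
        mono (\<lambda>\<tau>. wsr net k (V \<tau>)))"
proof (intro conjI allI impI)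
  fix V V' :: beams and lam alpha :: "nat \<Rightarrow> nat \<Rightarrow> real"
  assume "feasible net k V"
    and "\<forall>(u, i)\<in>active_slots net k.
           0 < lam u i \<and> lambda_max (L_mat net k V u i) \<le> lam u i \<and>
           0 < alpha u i \<and> alpha u i < 2 \<and>
           V' u i = bounded_update net k V (lam u i) (alpha u i) u i"
  then show "wsr net k V \<le> wsr net k V'"
    by (intro wsr_bounded_update[OF assms, of V lam alpha V']) auto
next
  fix V :: "nat \<Rightarrow> beams" and lam alpha :: "nat \<Rightarrow> nat \<Rightarrow> nat \<Rightarrow> real"
  assume V0: "feasible net k (V 0)"
    and *: "\<forall>\<tau>\<ge>1. \<forall>(u, i)\<in>active_slots net k.
           0 < lam \<tau> u i \<and> lambda_max (L_mat net k (V (\<tau> - 1)) u i) \<le> lam \<tau> u i \<and>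
           0 < alpha \<tau> u i \<and> alpha \<tau> u i < 2 \<and>
           V \<tau> u i = bounded_update net k (V (\<tau> - 1)) (lam \<tau> u i) (alpha \<tau> u i) u i"
  have step: "0 < lam (Suc n) u i \<and> lambda_max (L_mat net k (V n) u i) \<le> lam (Suc n) u i \<and>
      0 < alpha (Suc n) u i \<and> alpha (Suc n) u i < 2 \<and>
      V (Suc n) u i = bounded_update net k (V n) (lam (Suc n) u i) (alpha (Suc n) u i) u i"
    if "(u, i) \<in> active_slots net k" for n u i
    using *[rule_format, of "Suc n" "(u, i)"] that by simp
  \<comment> \<open>Only the starting point is assumed feasible; the projection keeps every later
    iterate in the ball.\<close>
  have "feasible net k (V n)" for n
  proof (induction n)
    case (Suc n)
    show ?case
      by (rule feasible_bounded_update[OF assms Suc, of _ "lam (Suc n)" "alpha (Suc n)"])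
        (use step[of _ _ n] in blast)
  qed (rule V0)
  then have "wsr net k (V n) \<le> wsr net k (V (Suc n))" for n
    by (rule wsr_bounded_update[OF assms, of _ "lam (Suc n)" "alpha (Suc n)"]) (rule step)
  then show "mono (\<lambda>\<tau>. wsr net k (V \<tau>))"
    by (simp add: mono_iff_le_Suc)
qed

end
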